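(* Let $\mathfrak{F}\subseteq\mathfrak{F}_{\mathrm{all}}$ satisfy $\mathfrak{F}\supseteq\mathfrak{F}_{\mathrm{AR}(2)}$ and suppose that the cyclical trend assumption holds: $X=(E_{n,0}(\omega),\tilde X)$ for some $\omega\in(0,\pi)$, where $E_{n,0}(\omega)$ is the $n\times2$ matrix with $j$-th row $(\cos(j\omega),\sin(j\omega))$ and $\tilde X$ is an $n\times(k-2)$-dimensional matrix such that $X$ has rank $k$ ($\tilde X$ is the empty matrix if $k=2$), and the restriction matrix $R$ has a nonzero column $R_{\cdot i}$ for some $i\in\{1,2\}$. Let $T$ be a nonsphericity-corrected F-type test statistic based on $\check\beta$ and $\check\Omega$, where $(\check\beta,\check\Omega,N)$ satisfies the estimator conditions with $N=\emptyset$. Furthermore, assume that $\check\Omega(y)$ is nonnegative definite for every $y\in\mathbb{R}^n$. Then $$\sup_{f\in\mathfrak{F}}P_{\mu_0,\sigma^2\Sigma(f)}(T\ge C)=1$$ holds for every critical value $C$, $-\infty<C<\infty$, for every $\mu_0\in\mathfrak{M}_0$, and for every $\sigma^2\in(0,\infty)$.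
   Context: Model: $n,k,q$ are positive integers with $1\le k<n$; $X\in\mathbb{R}^{n\times k}$ is a fixed matrix of rank $k$; $R\in\mathbb{R}^{q\times k}$ has rank $q\ge 1$; $r\in\mathbb{R}^q$. (One tests $R\beta=r$ in $\mathbf{Y}=X\beta+\mathbf{U}$, $\mathbf{U}\sim N(0,\sigma^2\Sigma(f))$, $0<\sigma^2<\infty$, $f\in\mathfrak{F}$.) $'$ is transpose, $\mathfrak{M}_0=\{X\beta:R\beta=r\}$. $P_{\mu,A}$ is the Gaussian measure on $\mathbb{R}^n$ with mean $\mu$ and covariance $A$; $P(T\ge C)$ means $P(\{y:T(y)\ge C\})$. $\lambda_{\mathbb{R}^n}$ is Lebesgue measure. Spectral densities: $\mathfrak{F}_{\mathrm{all}}$ is the set of all normalized spectral densities of real weakly stationary processes (nonnegative, even, integrable $f$ on $[-\pi,\pi]$ with $\int_{-\pi}^{\pi}f=1$); $\mathfrak{F}_{\mathrm{AR}(2)}$ is the subset of those corresponding to stationary autoregressive processes of order at most two; $\Sigma(f)=\left[\int_{-\pi}^{\pi}e^{-\iota(j-l)\nu}f(\nu)d\nu\right]_{j,l=1}^n$, $\iota$ the imaginary unit. Estimator conditions on $(\check\beta,\check\Omega,N)$: (i) $\check\beta:\mathbb{R}^n\setminus N\to\mathbb{R}^k$ and $\check\Omega:\mathbb{R}^n\setminus N\to\mathbb{R}^{q\times q}$ are well-defined and continuous on $\mathbb{R}^n\setminus N$, where $N$ is a closed $\lambda_{\mathbb{R}^n}$-null set, and $\check\Omega(y)$ is symmetric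 for every $y\in\mathbb{R}^n\setminus N$; (ii) $y\in\mathbb{R}^n\setminus N$ implies $\delta y+X\eta\in\mathbb{R}^n\setminus N$ for all $\delta\ne0$, $\eta\in\mathbb{R}^k$; (iii) $\check\beta(\delta y+X\eta)=\delta\check\beta(y)+\eta$ and $\check\Omega(\delta y+X\eta)=\delta^2\check\Omega(y)$ for all $y\in\mathbb{R}^n\setminus N$, $\delta\neq0$, $\eta\in\mathbb{R}^k$; (iv) $\check\Omega$ is $\lambda_{\mathbb{R}^n}$-almost everywhere nonsingular on $\mathbb{R}^n\setminus N$. Nonsphericity-corrected F-type test statistic: with $N^*=N\cup\{y\in\mathbb{R}^n\setminus N:\det\check\Omega(y)=0\}$, $T(y)=(R\check\beta(y)-r)'\check\Omega^{-1}(y)(R\check\beta(y)-r)$ for $y\in\mathbb{R}^n\setminus N^*$ and $T(y)=0$ for $y\in N^*$. *)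

theory Defs
  imports "HOL-Probability.Probability"
begin

text \<open>
  Vectors and matrices are indexed by finite linearly ordered types; \<open>pos i\<close> is the 1-based
  position of the index \<open>i\<close>, so that the elements of \<open>'n\<close> are numbered from 1 to \<open>CARD('n)\<close>.
\<close>

definition pos :: "'a::{finite,linorder} \<Rightarrow> nat" where
  "pos i = card {j. j \<le> i}"


section \<open>Spectral densities\<close>

text \<open>
  A function with domain \<open>[-\<pi>,\<pi>]\<close> is represented by a function on the reals that is
  extensional on \<open>{-pi..pi}\<close> (fixed to \<open>undefined\<close> outside), so that it is determined by its
  values on that interval.
\<close>

definition F_all :: "(real \<Rightarrow> real) set" where
  "F_all = {f \<in> extensional {-pi..pi}.
      (\<forall>x\<in>{-pi..pi}. 0 \<le> f x) \<and>
      (\<forall>x\<in>{-pi..pi}. f (-x) = f x) \<and>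
      set_integrable lebesgue {-pi..pi} f \<and>
      (LINT x:{-pi..pi}|lebesgue. f x) = 1}"

definition ar2_poly :: "real \<Rightarrow> real \<Rightarrow> complex \<Rightarrow> complex" where
  "ar2_poly a b z = 1 - of_real a * z - of_real b * z\<^sup>2"

text \<open>
  The stationary autoregression \<open>Z\<^sub>t = a Z\<^sub>t\<^sub>-\<^sub>1 + b Z\<^sub>t\<^sub>-\<^sub>2 + \<epsilon>\<^sub>t\<close>, with white noise \<open>\<epsilon>\<close> of variance
  \<open>s > 0\<close> and autoregressive polynomial without zeros in the closed unit disc, has spectral
  density \<open>(s / 2\<pi>) |1 - a e\<^sup>-\<^sup>i\<^sup>\<nu> - b e\<^sup>-\<^sup>2\<^sup>i\<^sup>\<nu>|\<^sup>-\<^sup>2\<close>. Order at most two means that \<open>a = 0\<close> and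
  \<open>b = 0\<close> are allowed. Membership in \<open>F_all\<close> imposes the normalization, which determines \<open>s\<close>.
\<close>

definition F_AR2 :: "(real \<Rightarrow> real) set" where
  "F_AR2 = {f \<in> F_all. \<exists>a b s.
      0 < s \<and>
      (\<forall>z. cmod z \<le> 1 \<longrightarrow> ar2_poly a b z \<noteq> 0) \<and>
      (\<forall>x\<in>{-pi..pi}. f x = s / (2 * pi) / (cmod (ar2_poly a b (exp (- (\<i> * of_real x)))))\<^sup>2)}"

text \<open>
  The integral is real for even \<open>f\<close>; \<open>Re\<close> only converts the type.
\<close>

definition Sigma_mat :: "(real \<Rightarrow> real) \<Rightarrow> real^'n::{finite,linorder}^'n::{finite,linorder}" where
  "Sigma_mat f = (\<chi> j l.
      Re (LINT x:{-pi..pi}|lebesgue.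
            exp (- (\<i> * of_real ((real (pos j) - real (pos l)) * x))) * of_real (f x)))"


section \<open>Gaussian measures\<close>

definition std_gaussian :: "(real^'n::finite) measure" where
  "std_gaussian = density lborel (\<lambda>z. ennreal (\<Prod>i\<in>UNIV. std_normal_density (z $ i)))"

text \<open>
  The Gaussian measure with mean \<open>\<mu>\<close> and covariance \<open>A\<close> is the law of \<open>\<mu> + B Z\<close> for a standard
  Gaussian vector \<open>Z\<close> and a square root \<open>B B' = A\<close>. A square root exists for every symmetric
  nonnegative definite \<open>A\<close>, and by rotation invariance of the standard Gaussian the law does not
  depend on the choice of \<open>B\<close>. Singular \<open>A\<close> are covered.
\<close>

definition gaussian :: "real^'n \<Rightarrow> real^'n^'n \<Rightarrow> (real^'n::finite) measure" where
  "gaussian \<mu> A =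
     (let B = (SOME B :: real^'n^'n. B ** transpose B = A)
      in distr std_gaussian borel (\<lambda>z. \<mu> + B *v z))"


section \<open>The regression model, estimators and test statistic\<close>

definition M0 :: "real^'k^'n \<Rightarrow> real^'k^'q \<Rightarrow> real^'q \<Rightarrow> (real^'n) set" where
  "M0 X R r = {X *v \<beta> |\<beta>. R *v \<beta> = r}"

text \<open>
  The first two columns of \<open>X\<close> are \<open>(cos(j\<omega>), sin(j\<omega>))\<^sub>j\<close>; the remaining ones are arbitrary.
\<close>

definition cyclical_design :: "real \<Rightarrow> real^'k::{finite,linorder}^'n::{finite,linorder} \<Rightarrow> bool" where
  "cyclical_design \<omega> X \<longleftrightarrow>
     2 \<le> CARD('k) \<and>
     (\<forall>j i. pos i = 1 \<longrightarrow> X $ j $ i = cos (real (pos j) * \<omega>)) \<and>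
     (\<forall>j i. pos i = 2 \<longrightarrow> X $ j $ i = sin (real (pos j) * \<omega>))"

text \<open>
  The estimators are total functions here, but only their values outside \<open>N\<close> are constrained.
\<close>

definition estimator_conditions ::
  "real^'k^'n \<Rightarrow> (real^'n \<Rightarrow> real^'k) \<Rightarrow> (real^'n \<Rightarrow> real^'q^'q) \<Rightarrow> (real^'n) set \<Rightarrow> bool" where
  "estimator_conditions X \<beta> \<Omega> N \<longleftrightarrow>
     closed N \<and> N \<in> null_sets lebesgue \<and>
     continuous_on (- N) \<beta> \<and> continuous_on (- N) \<Omega> \<and>
     (\<forall>y. y \<notin> N \<longrightarrow> transpose (\<Omega> y) = \<Omega> y) \<and>
     (\<forall>y \<delta> \<eta>. y \<notin> N \<longrightarrow> \<delta> \<noteq> 0 \<longrightarrow> \<delta> *\<^sub>R y + X *v \<eta> \<notin> N) \<and>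
     (\<forall>y \<delta> \<eta>. y \<notin> N \<longrightarrow> \<delta> \<noteq> 0 \<longrightarrow>
        \<beta> (\<delta> *\<^sub>R y + X *v \<eta>) = \<delta> *\<^sub>R \<beta> y + \<eta> \<and>
        \<Omega> (\<delta> *\<^sub>R y + X *v \<eta>) = \<delta>\<^sup>2 *\<^sub>R \<Omega> y) \<and>
     (AE y in lebesgue. y \<notin> N \<longrightarrow> det (\<Omega> y) \<noteq> 0)"

definition F_type_statistic ::
  "real^'k^'q \<Rightarrow> real^'q \<Rightarrow> (real^'n \<Rightarrow> real^'k) \<Rightarrow> (real^'n \<Rightarrow> real^'q^'q) \<Rightarrow> (real^'n) set
     \<Rightarrow> real^'n \<Rightarrow> real" where
  "F_type_statistic R r \<beta> \<Omega> N y =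
     (if y \<in> N \<union> {y. y \<notin> N \<and> det (\<Omega> y) = 0} then 0
      else (R *v \<beta> y - r) \<bullet> (matrix_inv (\<Omega> y) *v (R *v \<beta> y - r)))"

definition nonneg_definite :: "real^'q^'q \<Rightarrow> bool" where
  "nonneg_definite A \<longleftrightarrow> transpose A = A \<and> (\<forall>v. 0 \<le> v \<bullet> (A *v v))"

end

theory Submission
  imports Defs "HOL-Computational_Algebra.Polynomial"
begin

text \<open>
  The autoregressions of order two with conjugate roots approaching \<open>e\<^sup>\<plusminus>\<^sup>i\<^sup>\<omega>\<close> have spectral measures
  that concentrate at \<open>\<plusminus>\<omega>\<close>, so \<open>\<Sigma>(f)\<close> tends to the matrix of rank two with entries
  \<open>cos((j - l)\<omega>)\<close>, which is the Gram matrix of the rows of \<open>E\<^sub>n\<^sub>,\<^sub>0(\<omega>)\<close>. The limiting Gaussian measure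
  thus lives on \<open>\<mu>\<^sub>0 + span E\<^sub>n\<^sub>,\<^sub>0(\<omega>)\<close>, inside the column space of \<open>X\<close>. Because \<open>N\<close> is empty,
  equivariance forces \<open>\<Omega>(X\<eta>) = 0\<close> and \<open>\<beta>(X\<eta>) = \<eta>\<close>, while \<open>R\<beta> - r \<noteq> 0\<close> almost surely in the
  limit. The open set \<open>|R\<beta> - r|\<^sup>2 > max C 0 \<cdot> trace \<Omega>\<close>, on which \<open>T \<ge> C\<close> as soon as \<open>\<Omega>\<close> is
  nonsingular, therefore has limiting probability one.
\<close>

subsection \<open>Linear algebra\<close>

lemma inner_gram: "u \<bullet> ((B ** transpose B) *v w) = (transpose B *v u) \<bullet> (transpose B *v w)"
  for B :: "real^'m^'n"
  by (simp add: matrix_vector_mul_assoc[symmetric] dot_lmul_matrix[symmetric] transpose_matrix_vector)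

text \<open>The quadratic form of a Gram matrix at \<open>u\<close> is the squared norm of the
  transpose applied to \<open>u\<close>, so the Gram matrix determines the kernel of the transpose.
  The range is the orthogonal complement of that kernel.\<close>

lemma range_matrix_eq_if_gram_eq:
  fixes A :: "real^'m^'n" and D :: "real^'p^'n"
  assumes "A ** transpose A = D ** transpose D"
  shows "range ((*v) A) = range ((*v) D)"
proof -
  have ker: "transpose A *v u = 0 \<longleftrightarrow> transpose D *v u = 0" for u
    using inner_gram[of u A u] inner_gram[of u D u] assms by (metis inner_eq_zero_iff)
  have comp: "(range ((*v) M))\<^sup>\<bottom> = {u. transpose M *v u = 0}" for M :: "real^'c^'n"
    by (auto simp: orthogonal_comp_def orthogonal_def dot_lmul_matrix[symmetric]
        inner_commute) (metis inner_eq_zero_iff)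
  have "(range ((*v) A))\<^sup>\<bottom> = (range ((*v) D))\<^sup>\<bottom>"
    by (simp only: comp ker)
  then show ?thesis
    by (metis orthogonal_comp_self matrix_vector_mul_linear linear_subspace_image subspace_UNIV)
qed

text \<open>Gram-Schmidt for the inner product with matrix \<open>A\<close>. The images
  \<open>A *v w i\<close> are fewer than the dimension, so some nonzero \<open>u\<close> is
  orthogonal to all of them; it is then normalised by its \<open>A\<close>-norm.\<close>

lemma posdef_orthonormal_family:
  fixes A :: "real^'n^'n"
  assumes pos: "\<And>v. v \<noteq> 0 \<Longrightarrow> 0 < v \<bullet> (A *v v)" and sym: "transpose A = A"
  shows "\<exists>w :: 'n \<Rightarrow> real^'n. \<forall>i\<in>S. \<forall>j\<in>S. w i \<bullet> (A *v w j) = (if i = j then 1 else 0)"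
proof (induction S rule: finite_induct[OF finite])
  case 1
  then show ?case by simp
next
  case (2 a S)
  then obtain w :: "'n \<Rightarrow> real^'n"
    where w: "\<And>i j. i \<in> S \<Longrightarrow> j \<in> S \<Longrightarrow> w i \<bullet> (A *v w j) = (if i = j then 1 else 0)"
    by blast
  let ?V = "(\<lambda>i. A *v w i) ` S"
  have "dim ?V \<le> card S"
    using dim_le_card'[of ?V] card_image_le[of S "\<lambda>i. A *v w i"] by simp
  also have "card S < CARD('n)"
    using 2 by (metis UNIV_I finite psubset_card_mono top.not_eq_extremum)
  finally have "dim (span ?V) < DIM(real^'n)"
    by simp
  then obtain u where u: "u \<noteq> 0" "\<And>y. y \<in> span ?V \<Longrightarrow> orthogonal u y"
    using orthogonal_to_subspace_exists by (metis span_span)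
  define c where "c = u \<bullet> (A *v u)"
  have c: "0 < c" using pos u(1) by (simp add: c_def)
  define w' where "w' = w(a := u /\<^sub>R sqrt c)"
  have symd: "x \<bullet> (A *v y) = y \<bullet> (A *v x)" for x y
    by (metis sym dot_lmul_matrix inner_commute transpose_matrix_vector)
  have uS: "u \<bullet> (A *v w j) = 0" if "j \<in> S" for j
    using u(2)[of "A *v w j"] that by (auto simp: orthogonal_def span_base)
  have aa: "w' a \<bullet> (A *v w' a) = 1"
    using c by (simp add: w'_def matrix_vector_mult_scaleR c_def[symmetric] divide_simps flip: power2_eq_square)
  have "w' i \<bullet> (A *v w' j) = (if i = j then 1 else 0)" if "i \<in> insert a S" "j \<in> insert a S" for i j
  proof (cases "i = a \<or> j = a")
    case True
    have "w' k \<bullet> (A *v w' a) = 0" "w' a \<bullet> (A *v w' k) = 0" if "k \<in> S" for k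
    proof -
      have "k \<noteq> a" using that 2 by blast
      then show "w' a \<bullet> (A *v w' k) = 0" by (simp add: w'_def uS that)
      then show "w' k \<bullet> (A *v w' a) = 0" using symd by metis
    qed
    then show ?thesis using that True aa by auto
  next
    case False
    then show ?thesis using that w by (auto simp: w'_def)
  qed
  then show ?case by blast
qed

text \<open>If the rows of \<open>W\<close> are orthonormal for \<open>A\<close>, then W A W' = 1.
  Hence A W' is the inverse of \<open>W\<close>, and (A W') (W A) = A exhibits it as a root.\<close>

lemma posdef_square_root_exists:
  fixes A :: "real^'n^'n"
  assumes pos: "\<And>v. v \<noteq> 0 \<Longrightarrow> 0 < v \<bullet> (A *v v)" and sym: "transpose A = A"
  shows "\<exists>B :: real^'n^'n. B ** transpose B = A"
proof -
  obtain w :: "'n \<Rightarrow> real^'n"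
    where w: "\<And>i j. w i \<bullet> (A *v w j) = (if i = j then 1 else 0)"
    using posdef_orthonormal_family[OF assms, where S = UNIV] by auto
  define W :: "real^'n^'n" where "W = (\<chi> i. w i)"
  have "(W ** (A ** transpose W)) $ i $ j = w i \<bullet> (A *v w j)" for i j
    by (simp add: W_def transpose_def matrix_matrix_mult_def matrix_vector_mult_def inner_vec_def)
  then have WAW: "W ** (A ** transpose W) = mat 1"
    by (simp add: vec_eq_iff w mat_def)
  then have inv: "(A ** transpose W) ** W = mat 1"
    using matrix_left_right_inverse by blast
  have "(A ** transpose W) ** transpose (A ** transpose W) = (A ** transpose W) ** (W ** A)"
    using sym by (simp add: matrix_transpose_mul)
  also have "\<dots> = A" using inv by (simp add: matrix_mul_assoc)
  finally show ?thesis by blast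
qed

text \<open>Cauchy-Schwarz for the semi-inner product of \<open>A\<close>, applied to each
  coordinate vector against \<open>w\<close> and summed over the coordinates. For nonsingular
  \<open>A\<close> and v = A w it bounds the quadratic form of the inverse at v below by |v|^2 /
  trace A.\<close>

lemma nonneg_definite_norm_square_le:
  fixes A :: "real^'q^'q"
  assumes "nonneg_definite A"
  shows "(norm (A *v w))\<^sup>2 \<le> trace A * (w \<bullet> (A *v w))"
proof -
  have psd: "0 \<le> v \<bullet> (A *v v)" and sym: "transpose A = A" for v
    using assms by (auto simp: nonneg_definite_def)
  have symd: "x \<bullet> (A *v y) = y \<bullet> (A *v x)" for x y
    by (metis sym dot_lmul_matrix inner_commute transpose_matrix_vector)
  have cs: "(x \<bullet> (A *v w))\<^sup>2 \<le> (x \<bullet> (A *v x)) * (w \<bullet> (A *v w))" for x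
  proof -
    let ?a = "x \<bullet> (A *v x)" and ?b = "x \<bullet> (A *v w)" and ?c = "w \<bullet> (A *v w)"
    have q: "0 \<le> ?a * t\<^sup>2 + 2 * ?b * t + ?c" for t
      using psd[of "t *\<^sub>R x + w"] symd[of w x]
      by (simp add: matrix_vector_right_distrib matrix_vector_mult_scaleR inner_add_left inner_add_right
          power2_eq_square algebra_simps)
    show ?thesis
    proof (cases "?a = 0")
      case True
      \<comment> \<open>With zero leading coefficient the form is affine in \<open>t\<close>; a
        nonzero slope would give it the value -1 at the chosen \<open>t\<close>.\<close>
      have "?b = 0"
      proof (rule ccontr)
        assume b: "?b \<noteq> 0"
        have "2 * ?b * (- (?c + 1) / (2 * ?b)) = - (?c + 1)" using b by simp
        then show False using q[of "- (?c + 1) / (2 * ?b)"] True by simp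
      qed
      then show ?thesis using True by simp
    next
      case False
      then have a: "0 < ?a" using psd[of x] by simp
      \<comment> \<open>The quadratic is evaluated at its minimiser.\<close>
      have "?a * (- ?b / ?a)\<^sup>2 + 2 * ?b * (- ?b / ?a) + ?c = ?c - ?b\<^sup>2 / ?a"
        using a by (simp add: field_simps power2_eq_square)
      then have "?b\<^sup>2 / ?a \<le> ?c" using q[of "- ?b / ?a"] by simp
      then show ?thesis using a by (simp add: field_simps)
    qed
  qed
  have "(norm (A *v w))\<^sup>2 = (\<Sum>i\<in>UNIV. ((A *v w) $ i)\<^sup>2)"
    by (simp only: power2_norm_eq_inner) (simp add: inner_vec_def power2_eq_square)
  also have "\<dots> \<le> (\<Sum>i\<in>UNIV. A $ i $ i * (w \<bullet> (A *v w)))"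
  proof (rule sum_mono)
    fix i
    show "((A *v w) $ i)\<^sup>2 \<le> A $ i $ i * (w \<bullet> (A *v w))"
      using cs[of "axis i 1"] by (simp add: inner_axis' matrix_vector_mul_component inner_axis)
  qed
  also have "\<dots> = trace A * (w \<bullet> (A *v w))"
    by (simp add: trace_def sum_distrib_right)
  finally show ?thesis .
qed

lemma matrix_inv_mult_vector:
  fixes A :: "real^'q^'q"
  assumes "det A \<noteq> 0"
  shows "A *v (matrix_inv A *v v) = v" and "matrix_inv A *v (A *v v) = v"
proof -
  have "A ** matrix_inv A = mat 1 \<and> matrix_inv A ** A = mat 1"
    using assms unfolding matrix_inv_def invertible_det_nz[symmetric] invertible_def by (rule someI_ex)
  then show "A *v (matrix_inv A *v v) = v" and "matrix_inv A *v (A *v v) = v"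
    by (simp_all add: matrix_vector_mul_assoc)
qed

lemma continuous_on_det:
  fixes g :: "'a::topological_space \<Rightarrow> real^'q^'q"
  assumes "\<And>i j. continuous_on S (\<lambda>y. g y $ i $ j)"
  shows "continuous_on S (\<lambda>y. det (g y))"
  unfolding det_def by (intro continuous_intros assms)

subsection \<open>The test statistic\<close>

text \<open>By Cramer's rule, the inverse in the statistic is a quotient of continuous functions.\<close>

lemma F_type_statistic_measurable:
  fixes R :: "real^'k^'q" and \<beta> :: "real^'n \<Rightarrow> real^'k" and \<Omega> :: "real^'n \<Rightarrow> real^'q^'q"
  assumes \<beta>: "continuous_on UNIV \<beta>" and \<Omega>: "continuous_on UNIV \<Omega>"
  shows "F_type_statistic R r \<beta> \<Omega> {} \<in> borel_measurable borel"
proof -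
  define v where "v y = R *v \<beta> y - r" for y
  define M where "M k y = (\<chi> i j. if j = k then v y $ i else \<Omega> y $ i $ j)" for k y
  have v: "continuous_on UNIV v"
    unfolding v_def by (intro continuous_intros matrix_vector_mult_linear_continuous_on[THEN continuous_on_compose2, OF \<beta>]) auto
  have \<Omega>c: "continuous_on UNIV (\<lambda>y. \<Omega> y $ i $ j)" for i j
    by (intro continuous_intros \<Omega>)
  have vc: "continuous_on UNIV (\<lambda>y. v y $ i)" for i
    by (intro continuous_intros v)
  have M: "continuous_on UNIV (\<lambda>y. M k y $ i $ j)" for k i j
    by (cases "j = k") (simp_all add: M_def \<Omega>c vc)
  have [measurable]: "(\<lambda>y. det (\<Omega> y)) \<in> borel_measurable borel"
    "\<And>k. (\<lambda>y. det (M k y)) \<in> borel_measurable borel" "\<And>i. (\<lambda>y. v y $ i) \<in> borel_measurable borel"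
    by (intro borel_measurable_continuous_onI continuous_on_det \<Omega>c M vc)+
  have "F_type_statistic R r \<beta> \<Omega> {} y =
     (if det (\<Omega> y) = 0 then 0 else \<Sum>k\<in>UNIV. v y $ k * (det (M k y) / det (\<Omega> y)))" for y
  proof (cases "det (\<Omega> y) = 0")
    case False
    have "matrix_inv (\<Omega> y) *v v y = (\<chi> k. det (M k y) / det (\<Omega> y))"
      using cramer[OF False] matrix_inv_mult_vector[OF False] unfolding M_def by blast
    then show ?thesis using False
      by (simp add: F_type_statistic_def v_def[symmetric] inner_vec_def)
  qed (simp add: F_type_statistic_def)
  then have "F_type_statistic R r \<beta> \<Omega> {} =
    (\<lambda>y. if det (\<Omega> y) = 0 then 0 else \<Sum>k\<in>UNIV. v y $ k * (det (M k y) / det (\<Omega> y)))"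
    by blast
  then show ?thesis by simp
qed

text \<open>Writing R \<beta> - r = \<Omega> w turns T into the quadratic form of \<Omega> at w. The
  trace inequality then bounds |R \<beta> - r|^2 by trace \<Omega> times T, and the trace
  cancels.\<close>

lemma F_type_statistic_ge:
  fixes R :: "real^'k^'q"
  assumes psd: "nonneg_definite (\<Omega> y)" and nz: "det (\<Omega> y) \<noteq> 0"
    and less: "max C 0 * trace (\<Omega> y) < (norm (R *v \<beta> y - r))\<^sup>2"
  shows "C \<le> F_type_statistic R r \<beta> \<Omega> {} y"
proof -
  define v where "v = R *v \<beta> y - r"
  define w where "w = matrix_inv (\<Omega> y) *v v"
  have Aw: "\<Omega> y *v w = v" using nz by (simp add: w_def matrix_inv_mult_vector)
  have T: "F_type_statistic R r \<beta> \<Omega> {} y = w \<bullet> (\<Omega> y *v w)"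
    using nz by (simp add: F_type_statistic_def Aw) (simp add: inner_commute w_def v_def)
  have lt: "max C 0 * trace (\<Omega> y) < trace (\<Omega> y) * (w \<bullet> (\<Omega> y *v w))"
    using less nonneg_definite_norm_square_le[OF psd, of w] by (simp add: Aw v_def)
  have "0 \<le> \<Omega> y $ i $ i" for i
  proof -
    have "0 \<le> axis i 1 \<bullet> (\<Omega> y *v axis i 1)"
      using psd by (simp add: nonneg_definite_def)
    then show ?thesis
      by (simp add: inner_axis' matrix_vector_mul_component inner_axis)
  qed
  then have "0 \<le> trace (\<Omega> y)" by (simp add: trace_def sum_nonneg)
  \<comment> \<open>The strict inequality excludes a zero trace, so nonnegativity of the trace is
    enough to cancel it.\<close>
  then have "max C 0 < w \<bullet> (\<Omega> y *v w)"
    using lt by (metis mult.commute mult_right_less_imp_less)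
  then show ?thesis unfolding T by simp
qed

text \<open>Because \<open>N\<close> is empty, equivariance holds at the origin. Scaling by 2 there
  forces both estimators to vanish at 0, and translation with \<delta> = 1 carries this to the whole
  column space.\<close>

lemma estimators_on_span:
  fixes X :: "real^'k^'n"
  assumes "estimator_conditions X \<beta> \<Omega> {}"
  shows "\<beta> (X *v \<eta>) = \<eta>" and "\<Omega> (X *v \<eta>) = 0"
proof -
  have equiv: "\<beta> (\<delta> *\<^sub>R y + X *v \<eta>) = \<delta> *\<^sub>R \<beta> y + \<eta>" "\<Omega> (\<delta> *\<^sub>R y + X *v \<eta>) = \<delta>\<^sup>2 *\<^sub>R \<Omega> y"
    if "\<delta> \<noteq> 0" for \<delta> y \<eta>
    using assms that unfolding estimator_conditions_def by auto
  have "\<beta> 0 = 2 *\<^sub>R \<beta> 0" using equiv(1)[of 2 0 0] by simp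
  then have "\<beta> 0 = 0" using scaleR_cancel_right[of 1 "\<beta> 0" 2] by simp
  then show "\<beta> (X *v \<eta>) = \<eta>" using equiv(1)[of 1 0 \<eta>] by simp
  have "\<Omega> 0 = 4 *\<^sub>R \<Omega> 0" using equiv(2)[of 2 0 0] by simp
  then have "\<Omega> 0 = 0" using scaleR_cancel_right[of 1 "\<Omega> 0" 4] by simp
  then show "\<Omega> (X *v \<eta>) = 0" using equiv(2)[of 1 0 \<eta>] by simp
qed

lemma open_blowup_region:
  fixes R :: "real^'k^'q" and \<beta> :: "real^'n \<Rightarrow> real^'k" and \<Omega> :: "real^'n \<Rightarrow> real^'q^'q"
  assumes "continuous_on UNIV \<beta>" and "continuous_on UNIV \<Omega>"
  shows "open {y. c * trace (\<Omega> y) < (norm (R *v \<beta> y - r))\<^sup>2}"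
proof -
  have "continuous_on UNIV (\<lambda>y. R *v \<beta> y)"
    by (rule continuous_on_compose2[OF matrix_vector_mult_linear_continuous_on assms(1)]) auto
  then show ?thesis
    unfolding trace_def by (intro open_Collect_less continuous_intros assms(2))
qed

subsection \<open>Spectral densities\<close>

text \<open>The coefficients are the sum and the negated product of the conjugate pair \<rho>
  cis(\<omega>), \<rho> cis(-\<omega>). For 0 < \<rho> < 1 the zeros therefore have modulus 1/\<rho>
  and approach the unit circle at the angles \<plusminus>\<omega> as \<rho> tends to 1.\<close>

lemma ar2_poly_resonant_factor:
  "ar2_poly (2 * \<rho> * cos \<omega>) (- \<rho>\<^sup>2) z = (1 - of_real \<rho> * cis \<omega> * z) * (1 - of_real \<rho> * cis (- \<omega>) * z)"
proof -
  have "cis \<omega> + cis (- \<omega>) = of_real (2 * cos \<omega>)" "cis \<omega> * cis (- \<omega>) = 1"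
    by (simp_all add: complex_eq_iff cis_mult)
  note sum_prod = this
  have prod: "(1 - r * c * z) * (1 - r * d * z) = 1 - r * (c + d) * z + r\<^sup>2 * (c * d) * z\<^sup>2"
    for r c d :: complex
    by (simp add: power2_eq_square algebra_simps)
  show ?thesis unfolding prod sum_prod by (simp add: ar2_poly_def mult.assoc mult.left_commute)
qed

lemma ar2_poly_resonant_nonzero:
  assumes "0 \<le> \<rho>" "\<rho> < 1" "cmod z \<le> 1"
  shows "ar2_poly (2 * \<rho> * cos \<omega>) (- \<rho>\<^sup>2) z \<noteq> 0"
proof -
  have "1 - of_real \<rho> * cis \<theta> * z \<noteq> 0" for \<theta>
  proof
    assume "1 - of_real \<rho> * cis \<theta> * z = 0"
    then have "cmod (of_real \<rho> * cis \<theta> * z) = 1" by (metis eq_iff_diff_eq_0 norm_one)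
    moreover have "cmod (of_real \<rho> * cis \<theta> * z) \<le> \<rho> * 1"
      using assms by (simp add: norm_mult mult_left_le)
    ultimately show False using assms by simp
  qed
  then show ?thesis unfolding ar2_poly_resonant_factor by simp
qed

text \<open>The limiting case \<rho> = 1. For |z| = 1, taking out the factor z leaves z + 1/z - 2
  cos \<omega>, which is real.\<close>

lemma ar2_poly_unit_root:
  "cmod (ar2_poly (2 * cos \<omega>) (- 1) (exp (- (\<i> * of_real x)))) = 2 * \<bar>cos x - cos \<omega>\<bar>"
proof -
  have "exp (- (\<i> * of_real x)) = cis (- x)" by (simp add: cis_conv_exp)
  moreover have "ar2_poly (2 * cos \<omega>) (- 1) (cis (- x)) = cis (- x) * of_real (2 * (cos x - cos \<omega>))"
  proof -
    have "cis x + cis (- x) = of_real (2 * cos x)" "cis (- x) * cis x = 1"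
      by (simp_all add: complex_eq_iff cis_mult)
    note sum_prod = this
    have "1 - w * c + c\<^sup>2 = c * ((d + c) - w)" if "c * d = 1" for c d w :: complex
      using that by (simp add: power2_eq_square algebra_simps)
    from this[OF sum_prod(2), of "of_real (2 * cos \<omega>)"] show ?thesis
      unfolding sum_prod(1) by (simp add: ar2_poly_def algebra_simps)
  qed
  ultimately show ?thesis
    by (simp only: norm_mult norm_of_real norm_cis abs_mult)
qed

text \<open>Each of the two coefficients moves by at most 2 (1 - \<rho>) when \<rho> is replaced by
  1, uniformly in the frequency. The estimate is used in both directions: from above for the mass
  near \<omega>, from below for the mass away from it.\<close>

lemma ar2_poly_resonant_close:
  assumes "0 \<le> \<rho>" "\<rho> \<le> 1"
  shows "\<bar>cmod (ar2_poly (2 * \<rho> * cos \<omega>) (- \<rho>\<^sup>2) (exp (- (\<i> * of_real x)))) - 2 * \<bar>cos x - cos \<omega>\<bar>\<bar>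
    \<le> 4 * (1 - \<rho>)"
proof -
  define z where "z = exp (- (\<i> * of_real x))"
  have z: "cmod z = 1" by (simp add: z_def)
  let ?p = "ar2_poly (2 * \<rho> * cos \<omega>) (- \<rho>\<^sup>2) z" and ?q = "ar2_poly (2 * cos \<omega>) (- 1) z"
  have "?p - ?q = of_real (2 * (1 - \<rho>) * cos \<omega>) * z - of_real (1 - \<rho>\<^sup>2) * z\<^sup>2"
    by (simp add: ar2_poly_def algebra_simps)
  also have "cmod \<dots> \<le> cmod (of_real (2 * (1 - \<rho>) * cos \<omega>) * z) + cmod (of_real (1 - \<rho>\<^sup>2) * z\<^sup>2)"
    by (rule norm_triangle_ineq4)
  also have "\<dots> = \<bar>2 * (1 - \<rho>) * cos \<omega>\<bar> + \<bar>1 - \<rho>\<^sup>2\<bar>"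
    by (simp only: norm_mult norm_power z norm_of_real) simp
  also have "\<bar>2 * (1 - \<rho>) * cos \<omega>\<bar> \<le> 2 * (1 - \<rho>) * 1"
    using assms by (subst abs_mult) (intro mult_mono; simp)
  also have "\<bar>1 - \<rho>\<^sup>2\<bar> \<le> 2 * (1 - \<rho>)"
  proof -
    have "1 - \<rho>\<^sup>2 = (1 - \<rho>) * (1 + \<rho>)" by (simp add: power2_eq_square algebra_simps)
    then show ?thesis using assms mult_mono[of "1 - \<rho>" "1 - \<rho>" "1 + \<rho>" 2] by (simp add: abs_mult)
  qed
  finally have "cmod (?p - ?q) \<le> 4 * (1 - \<rho>)" by simp
  then have "\<bar>cmod ?p - cmod ?q\<bar> \<le> 4 * (1 - \<rho>)"
    using norm_triangle_ineq3[of ?p ?q] by linarith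
  then show ?thesis using ar2_poly_unit_root[of \<omega> x] by (simp add: z_def)
qed

section \<open>Concentration of the resonant densities at the cyclical frequency\<close>

lemma cos_lipschitz: "\<bar>cos x - cos y\<bar> \<le> \<bar>x - y\<bar>" for x y :: real
proof -
  have "\<bar>cos x - cos y\<bar> = 2 * \<bar>sin ((x + y) / 2)\<bar> * \<bar>sin ((y - x) / 2)\<bar>"
    by (simp add: cos_diff_cos abs_mult)
  also have "\<dots> \<le> 2 * 1 * \<bar>(y - x) / 2\<bar>"
    by (intro mult_mono abs_sin_x_le_abs_x) auto
  finally show ?thesis by simp
qed

lemma set_integrable_continuous:
  fixes f :: "real \<Rightarrow> real"
  assumes "continuous_on {a..b} f"
  shows "set_integrable lebesgue {a..b} f"
  using absolutely_integrable_continuous_real[OF assms] .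

text \<open>The constant comes from \<open>|1 - 2\<rho> cos \<omega> z + \<rho>\<^sup>2 z\<^sup>2| \<le> 6 (1 - \<rho>)\<close>
  on \<open>|x - \<omega>| \<le> 1 - \<rho>\<close>.\<close>

lemma resonant_integral_ge:
  assumes \<omega>: "0 < \<omega>" "\<omega> < pi" and e: "0 < e" "e < 1" "e < \<omega>"
  shows "1 / (36 * e) \<le>
    (LINT x:{-pi..pi}|lebesgue. 1 / (cmod (ar2_poly (2 * (1 - e) * cos \<omega>) (- (1 - e)\<^sup>2) (exp (- (\<i> * of_real x)))))\<^sup>2)"
proof -
  define g where "g x = cmod (ar2_poly (2 * (1 - e) * cos \<omega>) (- (1 - e)\<^sup>2) (exp (- (\<i> * of_real x))))" for x
  have g0: "0 < g x" for x
    using ar2_poly_resonant_nonzero[of "1 - e" "exp (- (\<i> * of_real x))" \<omega>] e by (simp add: g_def)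
  have cont: "continuous_on S (\<lambda>x. 1 / (g x)\<^sup>2)" for S
    using g0 unfolding g_def ar2_poly_def by (intro continuous_intros) (auto simp: less_le)
  \<comment> \<open>A one-sided window of length \<open>e\<close> is used;
    \<open>e < \<omega>\<close> and \<open>\<omega> < pi\<close> place it inside the interval of
    integration.\<close>
  have "1 / (36 * e) = (LINT x:{\<omega> - e..\<omega>}|lebesgue. 1 / (36 * e\<^sup>2))"
    using e by (simp add: set_integral_const power2_eq_square divide_simps)
  also have "\<dots> \<le> (LINT x:{\<omega> - e..\<omega>}|lebesgue. 1 / (g x)\<^sup>2)"
  proof (intro set_integral_mono set_integrable_continuous cont continuous_intros)
    fix x assume x: "x \<in> {\<omega> - e..\<omega>}"
    have "g x \<le> 2 * \<bar>cos x - cos \<omega>\<bar> + 4 * e"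
      using ar2_poly_resonant_close[of "1 - e" \<omega> x] e by (simp add: g_def)
    also have "\<dots> \<le> 6 * e"
      using cos_lipschitz[of x \<omega>] x by auto
    finally have "(g x)\<^sup>2 \<le> (6 * e)\<^sup>2" using g0[of x] by (intro power_mono) auto
    then show "1 / (36 * e\<^sup>2) \<le> 1 / (g x)\<^sup>2"
      using g0[of x] e by (intro divide_left_mono) (auto simp: power_mult_distrib)
  qed
  also have "\<dots> \<le> (LINT x:{-pi..pi}|lebesgue. 1 / (g x)\<^sup>2)"
    unfolding set_lebesgue_integral_def
  proof -
    have int: "integrable lebesgue (\<lambda>x. indicat_real {a..b} x *\<^sub>R (1 / (g x)\<^sup>2))" for a b
      using set_integrable_continuous[OF cont] unfolding set_integrable_def .
    show "(LINT x|lebesgue. indicat_real {\<omega> - e..\<omega>} x *\<^sub>R (1 / (g x)\<^sup>2))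
        \<le> (LINT x|lebesgue. indicat_real {- pi..pi} x *\<^sub>R (1 / (g x)\<^sup>2))"
      by (rule integral_mono[OF int int]) (use \<omega> e in \<open>auto simp: indicator_def\<close>)
  qed
  finally show ?thesis by (simp add: g_def)
qed

text \<open>The unnormalised density 1/g^2 has total mass \<open>I\<close> of order at least 1/e.
  After normalisation, g^2 f equals 1/I, which is small, and (cos x - cos \<omega>)^2 is dominated
  by g^2 up to a small error, so the second moment of cos x - cos \<omega> tends to 0 with
  \<open>e\<close>.\<close>

lemma AR2_concentrating:
  assumes \<omega>: "0 < \<omega>" "\<omega> < pi" and t: "0 < t"
  obtains f where "f \<in> F_AR2" "continuous_on {-pi..pi} f" "\<And>x. x \<in> {-pi..pi} \<Longrightarrow> 0 < f x"
    "(LINT x:{-pi..pi}|lebesgue. (cos x - cos \<omega>)\<^sup>2 * f x) \<le> t"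
proof -
  \<comment> \<open>The first two bounds ensure \<open>e < 1\<close> and
    \<open>e < \<omega>\<close>; the third makes the final estimate 36 pi e + 8 e at most
    \<open>t\<close>.\<close>
  define e where "e = min (min (1/2) (\<omega> / 2)) (t / (36 * pi + 8))"
  have p8: "0 < 36 * pi + 8" by (simp add: add_pos_pos)
  have e: "0 < e" "e < 1" "e < \<omega>"
    using \<omega> t p8 unfolding e_def by (simp_all only: min_less_iff_conj min_less_iff_disj divide_pos_pos) auto
  have "e \<le> t / (36 * pi + 8)"
    unfolding e_def by simp
  then have et: "(36 * pi + 8) * e \<le> t" using p8 by (simp add: field_simps)
  define a b where "a = 2 * (1 - e) * cos \<omega>" and "b = - (1 - e)\<^sup>2"
  define g where "g x = cmod (ar2_poly a b (exp (- (\<i> * of_real x))))" for x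
  define I where "I = (LINT x:{-pi..pi}|lebesgue. 1 / (g x)\<^sup>2)"
  have nz: "ar2_poly a b z \<noteq> 0" if "cmod z \<le> 1" for z
    using ar2_poly_resonant_nonzero[of "1 - e" z \<omega>] e that by (simp add: a_def b_def)
  have g0: "0 < g x" for x
    using nz by (simp add: g_def)
  have contg: "continuous_on S g" for S
    unfolding g_def ar2_poly_def by (intro continuous_intros)
  have cont: "continuous_on S (\<lambda>x. 1 / (g x)\<^sup>2)" for S
    using g0 by (intro continuous_intros contg) (auto simp: less_le)
  have I: "1 / (36 * e) \<le> I"
    using resonant_integral_ge[OF \<omega> e] by (simp add: I_def g_def a_def b_def)
  then have I0: "0 < I" using e by (smt (verit) divide_pos_pos zero_less_numeral mult_pos_pos)
  have Ie: "1 / I \<le> 36 * e"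
    using I I0 e by (simp add: field_simps)
  define f where "f = (\<lambda>x\<in>{-pi..pi}. 1 / I * (1 / (g x)\<^sup>2))"
  have fx: "f x = 1 / I * (1 / (g x)\<^sup>2)" if "x \<in> {-pi..pi}" for x
    using that by (simp add: f_def)
  have contf: "continuous_on {-pi..pi} f"
    using continuous_on_mult_left[OF cont] by (subst continuous_on_cong[OF refl fx])
  have fpos: "0 < f x" if "x \<in> {-pi..pi}" for x
    using fx[OF that] I0 g0[of x] by simp
  have gneg: "g (- x) = g x" for x
  proof -
    have "ar2_poly a b (exp (- (\<i> * of_real (- x)))) = cnj (ar2_poly a b (exp (- (\<i> * of_real x))))"
      by (simp add: ar2_poly_def exp_cnj)
    then show ?thesis by (simp add: g_def)
  qed
  have int1: "(LINT x:{-pi..pi}|lebesgue. f x) = 1"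
  proof -
    have "(LINT x:{-pi..pi}|lebesgue. f x) = (LINT x:{-pi..pi}|lebesgue. 1 / I * (1 / (g x)\<^sup>2))"
      by (intro set_lebesgue_integral_cong) (auto simp: fx)
    also have "\<dots> = 1 / I * I" unfolding set_integral_mult_right I_def ..
    finally show ?thesis using I0 by simp
  qed
  have fF: "f \<in> F_all"
    unfolding F_all_def mem_Collect_eq
    using int1 fpos contf by (intro conjI ballI)
      (auto simp: fx gneg less_imp_le f_def[THEN arg_cong, of "\<lambda>f. f \<in> extensional _"] intro: set_integrable_continuous)
  have fAR: "f \<in> F_AR2"
    unfolding F_AR2_def
  proof (intro CollectI conjI exI)
    show "f \<in> F_all" by (rule fF)
    \<comment> \<open>The innovation variance that cancels the 2 pi in \<open>F_AR2\<close> and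
      leaves the normalising factor \<open>1 / I\<close>.\<close>
    show "0 < 2 * pi / I" using I0 by simp
    show "\<forall>z. cmod z \<le> 1 \<longrightarrow> ar2_poly a b z \<noteq> 0" using nz by blast
    show "\<forall>x\<in>{-pi..pi}. f x = 2 * pi / I / (2 * pi) / (cmod (ar2_poly a b (exp (- (\<i> * of_real x)))))\<^sup>2"
      by (auto simp: fx g_def)
  qed
  \<comment> \<open>The term \<open>18 * e\<close> is half of the bound 36 e on 1/I = g^2 f; the
    other term comes from the error 4 e between \<open>g\<close> and its unit-root limit.\<close>
  have bound: "(cos x - cos \<omega>)\<^sup>2 * f x \<le> 18 * e + 8 * e * f x" if "x \<in> {-pi..pi}" for x
  proof -
    have "2 * \<bar>cos x - cos \<omega>\<bar> \<le> g x + 4 * e"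
      using ar2_poly_resonant_close[of "1 - e" \<omega> x] e by (simp add: g_def a_def b_def)
    then have "(2 * \<bar>cos x - cos \<omega>\<bar>)\<^sup>2 \<le> (g x + 4 * e)\<^sup>2"
      by (rule power_mono) simp
    also have "\<dots> \<le> 2 * (g x)\<^sup>2 + 32 * e\<^sup>2"
      using zero_le_power2[of "g x - 4 * e"] by (simp add: power2_eq_square algebra_simps)
    also have "e\<^sup>2 \<le> e" using e by (simp add: power2_eq_square mult_left_le)
    finally have "(cos x - cos \<omega>)\<^sup>2 \<le> (g x)\<^sup>2 / 2 + 8 * e" by (simp add: power_mult_distrib)
    then have "(cos x - cos \<omega>)\<^sup>2 * f x \<le> ((g x)\<^sup>2 / 2 + 8 * e) * f x"
      using fpos[OF that] by (intro mult_right_mono) auto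
    also have "\<dots> = 1 / I / 2 + 8 * e * f x"
      using g0[of x] fx[OF that] I0 by (simp add: algebra_simps)
    finally show ?thesis using Ie by simp
  qed
  have "(LINT x:{-pi..pi}|lebesgue. (cos x - cos \<omega>)\<^sup>2 * f x)
      \<le> (LINT x:{-pi..pi}|lebesgue. 18 * e + 8 * e * f x)"
    by (intro set_integral_mono set_integrable_continuous continuous_intros contf bound)
  also have "\<dots> = 36 * pi * e + 8 * e"
    using e contf by (subst set_integral_add)
      (auto simp: int1 set_integral_const intro!: set_integrable_continuous continuous_intros)
  finally have "(LINT x:{-pi..pi}|lebesgue. (cos x - cos \<omega>)\<^sup>2 * f x) \<le> t"
    using et by (simp add: algebra_simps)
  with fAR contf fpos show thesis by (rule that)
qed

text \<open>cos(d x) is the Chebyshev polynomial of degree d in cos x, hence Lipschitz in cos x on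
  [-1,1]; the induction follows the three-term recurrence. This reduces every lag of the covariance
  to cos x - cos \<omega>.\<close>

lemma cos_multiple_lipschitz:
  "\<exists>K. \<forall>x. \<bar>cos (real d * x) - cos (real d * \<omega>)\<bar> \<le> K * \<bar>cos x - cos \<omega>\<bar>"
proof (induction d rule: less_induct)
  case (less d)
  show ?case
  proof (cases "d \<le> 1")
    case True
    then have "d = 0 \<or> d = 1" by auto
    then show ?thesis by (auto intro: exI[of _ 1])
  next
    case False
    then obtain m where d: "d = Suc (Suc m)" by (metis One_nat_def not_less_eq_eq Suc_le_D le_SucE not0_implies_Suc zero_le)
    obtain K1 where K1: "\<And>x. \<bar>cos (real (Suc m) * x) - cos (real (Suc m) * \<omega>)\<bar> \<le> K1 * \<bar>cos x - cos \<omega>\<bar>"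
      using less[of "Suc m"] d by auto
    obtain K0 where K0: "\<And>x. \<bar>cos (real m * x) - cos (real m * \<omega>)\<bar> \<le> K0 * \<bar>cos x - cos \<omega>\<bar>"
      using less[of m] d by auto
    have rec: "cos (real d * x) = 2 * cos x * cos (real (Suc m) * x) - cos (real m * x)" for x
    proof -
      have "real d * x = real (Suc m) * x + x" "real m * x = real (Suc m) * x - x"
        by (simp_all add: d algebra_simps)
      then show ?thesis by (simp only: cos_add cos_diff) simp
    qed
    have "\<bar>cos (real d * x) - cos (real d * \<omega>)\<bar> \<le> (2 * K1 + 2 + K0) * \<bar>cos x - cos \<omega>\<bar>" for x
    proof -
      let ?A = "cos (real (Suc m) * x)" and ?B = "cos (real (Suc m) * \<omega>)"
      have "cos (real d * x) - cos (real d * \<omega>) =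
         2 * cos x * (?A - ?B) + 2 * ?B * (cos x - cos \<omega>) - (cos (real m * x) - cos (real m * \<omega>))"
        by (simp only: rec) (simp add: algebra_simps)
      then have "\<bar>cos (real d * x) - cos (real d * \<omega>)\<bar> \<le>
         \<bar>2 * cos x * (?A - ?B)\<bar> + \<bar>2 * ?B * (cos x - cos \<omega>)\<bar> + \<bar>cos (real m * x) - cos (real m * \<omega>)\<bar>"
        by linarith
      also have "\<bar>2 * cos x * (?A - ?B)\<bar> \<le> 2 * \<bar>?A - ?B\<bar>"
        by (simp add: abs_mult mult_left_le_one_le)
      also have "\<bar>2 * ?B * (cos x - cos \<omega>)\<bar> \<le> 2 * \<bar>cos x - cos \<omega>\<bar>"
        by (simp add: abs_mult mult_left_le_one_le)
      finally show ?thesis using K1[of x] K0[of x] by (simp add: algebra_simps)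
    qed
    then show ?thesis by blast
  qed
qed

text \<open>A first moment is controlled by a second one through |u| \<le> t/2 + u^2/(2t), which is
  (|u| - t)^2 \<ge> 0. Since \<open>f\<close> has mass 1, each of the two terms contributes at most
  t/2.\<close>

lemma set_integral_cos_diff_le:
  assumes contf: "continuous_on {-pi..pi} f" and f0: "\<And>x. x \<in> {-pi..pi} \<Longrightarrow> 0 \<le> f x"
    and f1: "(LINT x:{-pi..pi}|lebesgue. f x) = 1"
    and le: "(LINT x:{-pi..pi}|lebesgue. (cos x - cos \<omega>)\<^sup>2 * f x) \<le> t\<^sup>2"
    and t: "0 < t" and K: "\<And>x. \<bar>h x - c\<bar> \<le> K * \<bar>cos x - cos \<omega>\<bar>"
    and conth: "continuous_on {-pi..pi} h"
  shows "\<bar>(LINT x:{-pi..pi}|lebesgue. h x * f x) - c\<bar> \<le> \<bar>K\<bar> * t"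
proof -
  have nz: "x \<in> S \<Longrightarrow> 2 * t \<noteq> 0" for x :: real and S using t by simp
  note int = set_integrable_continuous and ci = continuous_intros contf conth nz
  have "(LINT x:{-pi..pi}|lebesgue. h x * f x) - c =
      (LINT x:{-pi..pi}|lebesgue. h x * f x) - (LINT x:{-pi..pi}|lebesgue. c * f x)"
    by (simp add: f1)
  also have "\<dots> = (LINT x:{-pi..pi}|lebesgue. h x * f x - c * f x)"
    by (intro set_integral_diff(2)[symmetric] int ci)
  also have "\<bar>\<dots>\<bar> \<le> (LINT x:{-pi..pi}|lebesgue. \<bar>h x * f x - c * f x\<bar>)"
  proof -
    have "continuous_on {-pi..pi} (\<lambda>x. h x * f x - c * f x)" by (intro ci)
    from set_integral_norm_bound[OF int[OF this]] show ?thesis by simp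
  qed
  also have "\<dots> \<le> (LINT x:{-pi..pi}|lebesgue. \<bar>K\<bar> * (t / 2 * f x + 1 / (2 * t) * ((cos x - cos \<omega>)\<^sup>2 * f x)))"
  proof (intro set_integral_mono int ci)
    fix x assume x: "x \<in> {-pi..pi}"
    have "\<bar>cos x - cos \<omega>\<bar> \<le> t / 2 + 1 / (2 * t) * (cos x - cos \<omega>)\<^sup>2"
      using t zero_le_power2[of "\<bar>cos x - cos \<omega>\<bar> - t"]
      by (simp add: field_simps power2_eq_square)
    then have "\<bar>K\<bar> * \<bar>cos x - cos \<omega>\<bar> \<le> \<bar>K\<bar> * (t / 2 + 1 / (2 * t) * (cos x - cos \<omega>)\<^sup>2)"
      by (intro mult_left_mono) auto
    moreover have "K * \<bar>cos x - cos \<omega>\<bar> \<le> \<bar>K\<bar> * \<bar>cos x - cos \<omega>\<bar>"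
      by (intro mult_right_mono) auto
    ultimately have "\<bar>h x - c\<bar> \<le> \<bar>K\<bar> * (t / 2 + 1 / (2 * t) * (cos x - cos \<omega>)\<^sup>2)"
      using K[of x] by linarith
    then have "\<bar>h x - c\<bar> * f x \<le> \<bar>K\<bar> * (t / 2 + 1 / (2 * t) * (cos x - cos \<omega>)\<^sup>2) * f x"
      using f0[OF x] by (rule mult_right_mono)
    moreover have "\<bar>h x * f x - c * f x\<bar> = \<bar>h x - c\<bar> * f x"
      using f0[OF x] by (simp add: left_diff_distrib[symmetric] abs_mult)
    ultimately show "\<bar>h x * f x - c * f x\<bar> \<le>
        \<bar>K\<bar> * (t / 2 * f x + 1 / (2 * t) * ((cos x - cos \<omega>)\<^sup>2 * f x))"
      by (simp add: algebra_simps)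
  qed
  also have "\<dots> = \<bar>K\<bar> * (t / 2 * 1 + 1 / (2 * t) * (LINT x:{-pi..pi}|lebesgue. (cos x - cos \<omega>)\<^sup>2 * f x))"
    unfolding set_integral_mult_right
    by (subst set_integral_add(2)) ((intro int ci refl | assumption)+, simp only: set_integral_mult_right f1)
  also have "\<dots> \<le> \<bar>K\<bar> * (t / 2 * 1 + 1 / (2 * t) * t\<^sup>2)"
    using t le by (intro mult_left_mono add_left_mono) auto
  also have "\<dots> = \<bar>K\<bar> * t" using t by (simp add: power2_eq_square)
  finally show ?thesis .
qed

subsection \<open>Covariance matrices\<close>

lemma pos_inject: "pos i = pos j \<longleftrightarrow> i = j"
proof
  have less: "pos a < pos b" if "a < b" for a b :: 'a
    unfolding pos_def using that
    by (intro psubset_card_mono) (auto simp: atMost_def[symmetric] psubset_eq)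
  show "i = j" if "pos i = pos j"
    using less[of i j] less[of j i] that by (cases i j rule: linorder_cases) auto
qed simp

lemma range_pos: "range (pos :: 'a::{finite,linorder} \<Rightarrow> nat) = {1..CARD('a)}"
proof (rule card_subset_eq)
  show "range (pos :: 'a \<Rightarrow> nat) \<subseteq> {1..CARD('a)}"
  proof safe
    fix i :: 'a
    have "0 < pos i" unfolding pos_def card_gt_0_iff by auto
    moreover have "pos i \<le> CARD('a)" unfolding pos_def by (intro card_mono) auto
    ultimately show "pos i \<in> {1..CARD('a)}" by simp
  qed
  show "card (range (pos :: 'a \<Rightarrow> nat)) = card {1..CARD('a)}"
    by (simp add: card_image inj_on_def pos_inject)
qed simp

lemma Sigma_mat_cos:
  assumes "continuous_on {-pi..pi} f"
  shows "Sigma_mat f $ j $ l = (LINT x:{-pi..pi}|lebesgue. cos ((real (pos j) - real (pos l)) * x) * f x)"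
proof -
  let ?d = "real (pos j) - real (pos l)"
  let ?g = "\<lambda>x. exp (- (\<i> * of_real (?d * x))) * complex_of_real (f x)"
  have "set_integrable lebesgue {-pi..pi} ?g"
    by (intro absolutely_integrable_continuous_real continuous_intros assms)
  then have "Re (LINT x:{-pi..pi}|lebesgue. ?g x) = (LINT x:{-pi..pi}|lebesgue. Re (?g x))"
    unfolding set_lebesgue_integral_def set_integrable_def
    by (subst integral_Re[symmetric]) simp_all
  also have "(\<lambda>x. Re (?g x)) = (\<lambda>x. cos (?d * x) * f x)"
    by (simp add: fun_eq_iff Re_exp)
  finally show ?thesis unfolding Sigma_mat_def by simp
qed

lemma Sigma_mat_symmetric:
  assumes "continuous_on {-pi..pi} f"
  shows "transpose (Sigma_mat f) = Sigma_mat f"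
proof -
  have "cos ((real (pos j) - real (pos l)) * x) = cos ((real (pos l) - real (pos j)) * x)" for j l :: 'a and x
    by (metis cos_minus minus_diff_eq minus_mult_left)
  then have "Sigma_mat f $ l $ j = Sigma_mat f $ j $ l" for j l :: 'a
    unfolding Sigma_mat_cos[OF assms] by presburger
  then show ?thesis by (simp add: vec_eq_iff transpose_def)
qed

text \<open>The two sums are the real and imaginary parts of a polynomial at \<open>cis x\<close>.
  It has infinitely many zeros on the unit circle, so it vanishes, and injectivity of
  \<open>pos\<close> lets each coefficient be read off separately.\<close>

lemma trig_poly_eq_0_imp:
  fixes v :: "real^'n::{finite,linorder}"
  assumes "\<And>x. x \<in> {-pi..pi} \<Longrightarrow> (\<Sum>j\<in>UNIV. v $ j * cos (real (pos j) * x)) = 0"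
    and "\<And>x. x \<in> {-pi..pi} \<Longrightarrow> (\<Sum>j\<in>UNIV. v $ j * sin (real (pos j) * x)) = 0"
  shows "v = 0"
proof -
  define p where "p = (\<Sum>j\<in>UNIV. monom (complex_of_real (v $ j)) (pos j))"
  have root: "poly p (cis x) = 0" if "x \<in> {-pi..pi}" for x
  proof -
    have "poly p (cis x) = (\<Sum>j\<in>UNIV. of_real (v $ j) * cis (real (pos j) * x))"
      by (simp add: p_def poly_sum poly_monom Complex.DeMoivre)
    then show ?thesis using assms[OF that] by (simp add: complex_eq_iff)
  qed
  \<comment> \<open>A short arc inside [0, pi], where cosine alone is injective, already supplies
    infinitely many zeros.\<close>
  have "inj_on cis {0..1}"
  proof (rule inj_onI)
    fix x y :: real assume xy: "x \<in> {0..1}" "y \<in> {0..1}" "cis x = cis y"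
    then have "cos x = cos y" by (metis cis.sel(1))
    then show "x = y"
      by (rule cos_inj_pi[rotated 4]) (use xy(1,2) pi_gt3 in auto)
  qed
  then have "infinite (cis ` {0..1})"
    by (simp add: finite_image_iff infinite_Icc)
  moreover have "cis ` {0..1} \<subseteq> {z. poly p z = 0}"
    using root pi_gt3 by auto
  ultimately have "p = 0"
    using poly_roots_finite finite_subset by blast
  have "v $ l = 0" for l
  proof -
    have "coeff p (pos l) = complex_of_real (v $ l)"
      by (simp add: p_def coeff_sum coeff_monom pos_inject)
    then show ?thesis using \<open>p = 0\<close> by simp
  qed
  then show ?thesis by (simp add: vec_eq_iff)
qed

text \<open>The quadratic form is the integral of |\<Sum> v_j exp(i j x)|^2 f(x). A zero integral of
  this continuous nonnegative function would make the trigonometric polynomial vanish identically,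
  as \<open>f\<close> is positive.\<close>

lemma Sigma_mat_posdef:
  fixes v :: "real^'n::{finite,linorder}"
  assumes contf: "continuous_on {-pi..pi} f" and fpos: "\<And>x. x \<in> {-pi..pi} \<Longrightarrow> 0 < f x"
    and v: "v \<noteq> 0"
  shows "0 < v \<bullet> (Sigma_mat f *v v)"
proof -
  define c where "c x = (\<Sum>j\<in>UNIV. v $ j * cos (real (pos j) * x))" for x
  define s where "s x = (\<Sum>j\<in>UNIV. v $ j * sin (real (pos j) * x))" for x
  define h where "h x = ((c x)\<^sup>2 + (s x)\<^sup>2) * f x" for x
  have conth: "continuous_on {-pi..pi} h"
    unfolding h_def c_def s_def by (intro continuous_intros contf)
  have h0: "0 \<le> h x" if "x \<in> {-pi..pi}" for x
    using fpos[OF that] by (simp add: h_def)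
  have "v \<bullet> (Sigma_mat f *v v) = (\<Sum>j\<in>UNIV. \<Sum>l\<in>UNIV.
      (LINT x:{-pi..pi}|lebesgue. v $ j * v $ l * (cos ((real (pos j) - real (pos l)) * x) * f x)))"
    unfolding set_integral_mult_right
    by (simp add: inner_vec_def matrix_vector_mult_def Sigma_mat_cos[OF contf] sum_distrib_left mult_ac)
  also have "\<dots> = (LINT x:{-pi..pi}|lebesgue. (\<Sum>j\<in>UNIV. \<Sum>l\<in>UNIV.
      v $ j * v $ l * (cos ((real (pos j) - real (pos l)) * x) * f x)))"
  proof -
    have int: "integrable lebesgue (\<lambda>x. indicat_real {-pi..pi} x *\<^sub>R
        (v $ j * v $ l * (cos ((real (pos j) - real (pos l)) * x) * f x)))" for j l
      unfolding set_integrable_def[symmetric]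
      by (intro set_integrable_continuous continuous_intros contf)
    show ?thesis
      unfolding set_lebesgue_integral_def scaleR_sum_right
      by (simp only: Bochner_Integration.integrable_sum Bochner_Integration.integral_sum int)
  qed
  also have "\<dots> = (LINT x:{-pi..pi}|lebesgue. h x)"
  proof -
    have "(\<Sum>j\<in>UNIV. \<Sum>l\<in>UNIV. v $ j * v $ l * (cos ((real (pos j) - real (pos l)) * x) * f x)) = h x" for x
    proof -
      have "(c x)\<^sup>2 = (\<Sum>j\<in>UNIV. \<Sum>l\<in>UNIV. (v $ j * cos (real (pos j) * x)) * (v $ l * cos (real (pos l) * x)))"
        "(s x)\<^sup>2 = (\<Sum>j\<in>UNIV. \<Sum>l\<in>UNIV. (v $ j * sin (real (pos j) * x)) * (v $ l * sin (real (pos l) * x)))"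
        by (simp_all only: c_def s_def power2_eq_square sum_product)
      then have "h x = (\<Sum>j\<in>UNIV. \<Sum>l\<in>UNIV. ((v $ j * cos (real (pos j) * x)) * (v $ l * cos (real (pos l) * x))
          + (v $ j * sin (real (pos j) * x)) * (v $ l * sin (real (pos l) * x))) * f x)"
        by (simp only: h_def sum.distrib[symmetric] sum_distrib_right)
      then show ?thesis
        by (simp only:) (intro sum.cong refl; simp only: left_diff_distrib cos_diff; simp add: algebra_simps)
    qed
    then show ?thesis by simp
  qed
  also have "\<dots> = integral {-pi..pi} h"
    by (intro set_lebesgue_integral_eq_integral set_integrable_continuous conth)
  finally have eq: "v \<bullet> (Sigma_mat f *v v) = integral {-pi..pi} h" .
  have "integral {-pi..pi} h \<noteq> 0"
  proof
    assume "integral {-pi..pi} h = 0"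
    then have "\<forall>x\<in>{-pi..pi}. h x = 0"
      using integral_eq_0_iff[OF conth _ h0] by simp
    then have "c x = 0 \<and> s x = 0" if "x \<in> {-pi..pi}" for x
      using that fpos[OF that] by (fastforce simp: h_def sum_power2_eq_zero_iff)
    then show False using v trig_poly_eq_0_imp[of v] by (auto simp: c_def s_def)
  qed
  moreover have "0 \<le> integral {-pi..pi} h"
    by (intro integral_nonneg integrable_continuous_real conth h0)
  ultimately show ?thesis unfolding eq by simp
qed

text \<open>A second moment of at most 1/(m+1)^2 makes the error in each entry at most a constant,
  depending on the lag only, times 1/(m+1). The constant trace later bounds the square
  roots.\<close>

lemma resonant_covariances:
  assumes \<omega>: "0 < \<omega>" "\<omega> < pi"
  obtains f :: "nat \<Rightarrow> real \<Rightarrow> real"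
  where "\<And>m. f m \<in> F_AR2"
    and "\<And>m. transpose (Sigma_mat (f m)) = (Sigma_mat (f m) :: real^'n::{finite,linorder}^'n::{finite,linorder})"
    and "\<And>m (v :: real^'n::{finite,linorder}). v \<noteq> 0 \<Longrightarrow> 0 < v \<bullet> (Sigma_mat (f m) *v v)"
    and "\<And>m. trace (Sigma_mat (f m) :: real^'n::{finite,linorder}^'n::{finite,linorder}) = CARD('n)"
    and "\<And>j l :: 'n::{finite,linorder}. (\<lambda>m. Sigma_mat (f m) $ j $ l) \<longlonglongrightarrow> cos ((real (pos j) - real (pos l)) * \<omega>)"
proof -
  have "\<exists>f. f \<in> F_AR2 \<and> continuous_on {-pi..pi} f \<and> (\<forall>x\<in>{-pi..pi}. 0 < f x) \<and>
     (LINT x:{-pi..pi}|lebesgue. (cos x - cos \<omega>)\<^sup>2 * f x) \<le> (1 / real (Suc m))\<^sup>2" for m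
    by (rule AR2_concentrating[OF \<omega>, of "(1 / real (Suc m))\<^sup>2"]) auto
  then obtain f where "\<forall>m. f m \<in> F_AR2 \<and> continuous_on {-pi..pi} (f m) \<and> (\<forall>x\<in>{-pi..pi}. 0 < f m x) \<and>
     (LINT x:{-pi..pi}|lebesgue. (cos x - cos \<omega>)\<^sup>2 * f m x) \<le> (1 / real (Suc m))\<^sup>2"
    by (rule choice[OF allI, THEN exE])
  then have f: "\<And>m. f m \<in> F_AR2" "\<And>m. continuous_on {-pi..pi} (f m)"
    "\<And>m x. x \<in> {-pi..pi} \<Longrightarrow> 0 < f m x"
    "\<And>m. (LINT x:{-pi..pi}|lebesgue. (cos x - cos \<omega>)\<^sup>2 * f m x) \<le> (1 / real (Suc m))\<^sup>2"
    by blast+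
  have f1: "(LINT x:{-pi..pi}|lebesgue. f m x) = 1" for m
    using f(1)[of m] by (simp add: F_AR2_def F_all_def)
  have lim: "(\<lambda>m. Sigma_mat (f m) $ j $ l) \<longlonglongrightarrow> cos ((real (pos j) - real (pos l)) * \<omega>)" for j l :: 'n
  proof -
    \<comment> \<open>The Lipschitz estimate is for natural multiples; evenness of the cosine allows
      passing to the absolute lag.\<close>
    define d where "d = (if pos l \<le> pos j then pos j - pos l else pos l - pos j)"
    have d: "cos ((real (pos j) - real (pos l)) * x) = cos (real d * x)" for x
    proof (cases "pos l \<le> pos j")
      case False
      then have "real (pos j) - real (pos l) = - real d" by (simp add: d_def of_nat_diff)
      then show ?thesis by simp
    qed (simp add: d_def of_nat_diff)
    obtain K where K: "\<And>x. \<bar>cos (real d * x) - cos (real d * \<omega>)\<bar> \<le> K * \<bar>cos x - cos \<omega>\<bar>"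
      using cos_multiple_lipschitz by blast
    have "norm (Sigma_mat (f m) $ j $ l - cos (real d * \<omega>)) \<le> \<bar>K\<bar> * (1 / real (Suc m))" for m
      unfolding Sigma_mat_cos[OF f(2)] d real_norm_def
      by (rule set_integral_cos_diff_le[OF f(2) _ f1 f(4) _ K])
        (auto intro!: continuous_intros less_imp_le[OF f(3)])
    moreover have "(\<lambda>m. \<bar>K\<bar> * (1 / real (Suc m))) \<longlonglongrightarrow> \<bar>K\<bar> * 0"
      by (intro tendsto_mult tendsto_const LIMSEQ_inverse_real_of_nat[unfolded inverse_eq_divide])
    ultimately have "(\<lambda>m. Sigma_mat (f m) $ j $ l - cos (real d * \<omega>)) \<longlonglongrightarrow> 0"
      unfolding mult_zero_right by (rule Lim_null_comparison[OF always_eventually[OF allI]])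
    then show ?thesis unfolding d by (rule LIM_zero_cancel)
  qed
  have tr: "trace (Sigma_mat (f m) :: real^'n::{finite,linorder}^'n::{finite,linorder}) = CARD('n)" for m
    by (simp add: trace_def Sigma_mat_cos[OF f(2)] f1)
  show thesis
    by (rule that[OF f(1) Sigma_mat_symmetric[OF f(2)] Sigma_mat_posdef[OF f(2,3)] tr lim])
qed

text \<open>The subtraction formula for the cosine. Zeroing the other columns instead of dropping
  them keeps the type of \<open>X\<close>, so that \<open>K *v w\<close> is visibly \<open>X\<close>
  applied to a truncated vector.\<close>

lemma cyclical_gram:
  fixes X :: "real^'k::{finite,linorder}^'n::{finite,linorder}"
  assumes X: "cyclical_design \<omega> X"
    and K: "K = (\<chi> j i. if pos i \<in> {1, 2} then X $ j $ i else 0)"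
  shows "(K ** transpose K) $ j $ l = cos ((real (pos j) - real (pos l)) * \<omega>)"
proof -
  have "{1, 2} \<subseteq> range (pos :: 'k \<Rightarrow> nat)"
    using X by (auto simp: range_pos cyclical_design_def)
  then obtain i1 i2 :: 'k where i: "pos i1 = 1" "pos i2 = 2"
    by (metis (no_types, lifting) insert_subset rangeE)
  have ne: "i1 \<noteq> i2" using i by auto
  have other: "pos i \<in> {1, 2} \<longleftrightarrow> i \<in> {i1, i2}" for i
    using i by (metis insert_iff pos_inject singletonD)
  have entry: "K $ j $ i = (if i \<in> {i1, i2} then X $ j $ i else 0)" for j i
    by (simp only: K vec_lambda_beta other)
  have "(K ** transpose K) $ j $ l = (\<Sum>i\<in>UNIV. K $ j $ i * K $ l $ i)"
    by (simp add: matrix_matrix_mult_def transpose_def)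
  also have "\<dots> = (\<Sum>i\<in>{i1, i2}. X $ j $ i * X $ l $ i)"
    by (rule sum.mono_neutral_cong_right) (auto simp: entry)
  also have "\<dots> = cos ((real (pos j) - real (pos l)) * \<omega>)"
    using X i ne by (simp add: cyclical_design_def cos_diff left_diff_distrib)
  finally show ?thesis .
qed

subsection \<open>Standard Gaussian vectors\<close>

lemma prob_space_std_gaussian: "prob_space (std_gaussian :: (real^'n) measure)"
proof
  have B: "(Basis :: (real^'n) set) = (\<lambda>i. axis i 1) ` UNIV"
    by (auto simp: Basis_vec_def)
  have inj: "inj (\<lambda>i. axis i (1::real) :: real^'n)"
    by (auto simp: inj_on_def axis_eq_axis)
  have pr: "(\<Prod>i\<in>UNIV. std_normal_density (z $ i)) = (\<Prod>b\<in>Basis. std_normal_density (z \<bullet> b))" for z :: "real^'n"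
    unfolding B by (subst prod.reindex[OF inj]) (simp add: inner_axis)
  have "(\<integral>\<^sup>+z. ennreal (\<Prod>b\<in>Basis. std_normal_density (z \<bullet> b)) \<partial>(lborel :: (real^'n) measure))
      = (\<integral>\<^sup>+z. (\<Prod>b\<in>Basis. ennreal (std_normal_density (z \<bullet> b))) \<partial>(lborel :: (real^'n) measure))"
    by (simp add: prod_ennreal)
  also have "\<dots> = (\<Prod>b\<in>(Basis :: (real^'n) set). \<integral>\<^sup>+x. ennreal (std_normal_density x) \<partial>lborel)"
    by (rule nn_integral_lborel_prod) auto
  also have "(\<integral>\<^sup>+x. ennreal (std_normal_density x) \<partial>lborel) = 1"
    using prob_space.emeasure_space_1[OF prob_space_normal_density[of 1 0]]
    by (simp add: emeasure_density)
  finally show "emeasure std_gaussian (space (std_gaussian :: (real^'n) measure)) = 1"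
    by (simp add: std_gaussian_def emeasure_density pr)
qed

lemma sets_std_gaussian [measurable_cong, simp]: "sets std_gaussian = sets borel"
  by (simp add: std_gaussian_def)

lemma space_std_gaussian [simp]: "space std_gaussian = UNIV"
  by (simp add: std_gaussian_def)

lemma AE_std_gaussian_if_negligible:
  fixes P :: "real^'n \<Rightarrow> bool"
  assumes "negligible {z. \<not> P z}"
  shows "AE z in std_gaussian. P z"
proof -
  have "AE z in lborel. P z"
    using AE_I'[of "{z. \<not> P z}" lebesgue P] assms
    by (simp add: negligible_iff_null_sets AE_completion_iff)
  then show ?thesis
    unfolding std_gaussian_def by (subst AE_density) auto
qed

lemma affine_borel_measurable: "(\<lambda>z. \<mu> + B *v z) \<in> borel_measurable std_gaussian"
  for B :: "real^'m^'n"
proof -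
  have "continuous_on UNIV (\<lambda>z. \<mu> + B *v z)"
    by (intro continuous_intros)
  then show ?thesis
    by (simp cong: measurable_cong_sets add: borel_measurable_continuous_onI)
qed

text \<open>An injective affine map pulls negligible sets back to negligible sets, and the standard
  Gaussian has a Lebesgue density.\<close>

lemma AE_std_gaussian_affine:
  fixes B :: "real^'n^'n"
  assumes "det B \<noteq> 0" and "negligible {y. \<not> P y}"
  shows "AE z in std_gaussian. P (\<mu> + B *v z)"
proof (rule AE_std_gaussian_if_negligible)
  have "negligible {z \<in> UNIV. \<mu> + B *v z \<in> {y. \<not> P y}}"
  proof (rule negligible_differentiable_vimage[OF assms(2)])
    show "inj ((*v) B)"
      by (rule inj_on_inverseI[of _ "(*v) (matrix_inv B)"]) (simp add: matrix_inv_mult_vector assms)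
    show "((\<lambda>z. \<mu> + B *v z) has_derivative (*v) B) (at x within UNIV)" for x
      by (auto intro!: derivative_eq_intros bounded_linear_imp_has_derivative matrix_vector_mul_bounded_linear)
  qed
  then show "negligible {z. \<not> P (\<mu> + B *v z)}" by simp
qed

lemma negligible_kernel:
  fixes L :: "real^'n^'q"
  assumes "L *v z \<noteq> 0"
  shows "negligible {z. L *v z = 0}"
proof (rule negligible_lowdim)
  have sub: "subspace {z. L *v z = 0}"
    by (rule linear_subspace_kernel) simp
  have "{z. L *v z = 0} \<noteq> UNIV" using assms by blast
  then have "dim {z. L *v z = 0} \<noteq> DIM(real^'n)"
    using sub by (metis dim_eq_full span_eq_iff)
  then show "dim {z. L *v z = 0} < DIM(real^'n)"
    using dim_subset_UNIV[of "{z. L *v z = 0}"] by linarith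
qed

text \<open>Existence of a root makes the choice in \<open>gaussian\<close> meaningful. Any root
  \<open>B\<close> is nonsingular, since the kernel of its transpose is annihilated by the positive
  definite form.\<close>

lemma gaussian_square_root:
  fixes A :: "real^'n^'n"
  assumes "\<And>v. v \<noteq> 0 \<Longrightarrow> 0 < v \<bullet> (A *v v)" and "transpose A = A"
  obtains B where "B ** transpose B = A" "det B \<noteq> 0"
    "\<And>\<mu>. gaussian \<mu> A = distr std_gaussian borel (\<lambda>z. \<mu> + B *v z)"
proof -
  define B where "B = (SOME B :: real^'n^'n. B ** transpose B = A)"
  have BB: "B ** transpose B = A"
    unfolding B_def using posdef_square_root_exists[OF assms] by (rule someI_ex)
  have "inj ((*v) (transpose B))"
  proof (rule linear_injective_0[THEN iffD2, rule_format])
    fix v assume "transpose B *v v = 0"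
    then have "v \<bullet> (A *v v) = 0" using inner_gram[of v B v] BB by simp
    then show "v = 0" using assms(1)[of v] by fastforce
  qed simp
  then have "det (transpose B) \<noteq> 0"
    using det_nz_iff_inj[of "(*v) (transpose B)"] by simp
  then have "det B \<noteq> 0" by simp
  then show thesis
    by (rule that[OF BB]) (simp add: gaussian_def B_def Let_def)
qed

text \<open>The law is the image of a probability measure under an affine map, whichever matrix
  \<open>SOME\<close> returns. The upper bound on the supremum over all of \<open>\<FF>\<close>
  rests on this.\<close>

lemma prob_space_gaussian: "prob_space (gaussian \<mu> A)"
  unfolding gaussian_def Let_def
  by (intro prob_space.prob_space_distr prob_space_std_gaussian affine_borel_measurable)

text \<open>All laws are images of one Gaussian vector, so dominated convergence applies: if the
  limit point lies in the open set \<open>U\<close>, the approximating points eventually do, and the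
  indicators tend to 1.\<close>

lemma measure_std_gaussian_affine_tendsto:
  fixes B :: "nat \<Rightarrow> real^'n^'n"
  assumes U: "open U" and lim: "B \<longlonglongrightarrow> B0" and ae: "AE z in std_gaussian. \<mu> + B0 *v z \<in> U"
  shows "(\<lambda>m. measure (distr std_gaussian borel (\<lambda>z. \<mu> + B m *v z)) U) \<longlonglongrightarrow> 1"
proof -
  interpret prob_space "std_gaussian :: (real^'n) measure" by (rule prob_space_std_gaussian)
  have [measurable]: "(\<lambda>z. \<mu> + A *v z) \<in> std_gaussian \<rightarrow>\<^sub>M borel" for A :: "real^'n^'n"
    by (rule affine_borel_measurable)
  have [measurable]: "U \<in> sets borel" using U by simp
  have eq: "measure (distr std_gaussian borel (\<lambda>z. \<mu> + B m *v z)) U =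
      (LINT z|std_gaussian. indicat_real U (\<mu> + B m *v z))" for m
  proof -
    have "measure (distr std_gaussian borel (\<lambda>z. \<mu> + B m *v z)) U
       = (LINT z|distr std_gaussian borel (\<lambda>z. \<mu> + B m *v z). indicat_real U z)"
      by simp
    also have "\<dots> = (LINT z|std_gaussian. indicat_real U (\<mu> + B m *v z))"
      by (rule integral_distr) auto
    finally show ?thesis .
  qed
  have "(\<lambda>m. LINT z|std_gaussian. indicat_real U (\<mu> + B m *v z)) \<longlonglongrightarrow> (LINT z|(std_gaussian :: (real^'n) measure). 1)"
  proof (rule integral_dominated_convergence[where w = "\<lambda>_. 1"])
    show "AE z in std_gaussian. (\<lambda>m. indicat_real U (\<mu> + B m *v z)) \<longlonglongrightarrow> 1"
      using ae
    proof eventually_elim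
      case (elim z)
      have "(\<lambda>m. \<mu> + B m *v z) \<longlonglongrightarrow> \<mu> + B0 *v z"
        unfolding matrix_vector_mult_def
        by (intro tendsto_add tendsto_const tendsto_vec_lambda tendsto_sum tendsto_mult tendsto_vec_nth lim)
      then have "\<forall>\<^sub>F m in sequentially. \<mu> + B m *v z \<in> U"
        using U elim by (rule topological_tendstoD)
      then show ?case
        by (intro tendsto_eventually) (auto elim: eventually_mono)
    qed
  qed (auto simp: indicator_def)
  then show ?thesis unfolding eq by (simp add: prob_space[simplified])
qed

text \<open>The trace of B B' is the squared Euclidean norm of the entries of B, so the sequence is
  bounded and Bolzano-Weierstrass applies.\<close>

lemma matrix_sequence_convergent_subsequence:
  fixes B :: "nat \<Rightarrow> real^'n^'n"
  assumes tr: "\<And>m. trace (B m ** transpose (B m)) = c"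
  obtains B0 \<phi> where "strict_mono \<phi>" "(B \<circ> \<phi>) \<longlonglongrightarrow> B0"
proof -
  have "(norm (B m))\<^sup>2 = c" for m
  proof -
    have "(norm (B m))\<^sup>2 = (\<Sum>i\<in>UNIV. \<Sum>j\<in>UNIV. (B m $ i $ j) * (B m $ i $ j))"
      unfolding power2_norm_eq_inner inner_vec_def by simp
    then show ?thesis
      using tr[of m] by (simp add: trace_def matrix_matrix_mult_def transpose_def)
  qed
  then have "norm (B m) \<le> sqrt c" for m
    by (metis norm_ge_zero real_sqrt_unique order_refl)
  then have "bounded (range B)"
    by (auto simp: bounded_iff)
  then show thesis
    using bounded_imp_convergent_subsequence that by blast
qed

lemma gram_limit:
  fixes B :: "nat \<Rightarrow> real^'n^'n"
  assumes B: "B \<longlonglongrightarrow> B0"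
    and lim: "\<And>j l. (\<lambda>m. (B m ** transpose (B m)) $ j $ l) \<longlonglongrightarrow> A $ j $ l"
  shows "B0 ** transpose B0 = A"
proof -
  have "(\<lambda>m. (B m ** transpose (B m)) $ j $ l) \<longlonglongrightarrow> (B0 ** transpose B0) $ j $ l" for j l
    unfolding matrix_matrix_mult_def transpose_def vec_lambda_beta
    by (intro tendsto_sum tendsto_mult tendsto_vec_nth B)
  then show ?thesis
    using LIMSEQ_unique[OF _ lim] by (simp add: vec_eq_iff)
qed

subsection \<open>Blow-up of the statistic\<close>

text \<open>\<open>B\<close> and the scaled cyclical columns \<open>D\<close> share their Gram
  matrix, hence their range, which lies in the column space of \<open>X\<close>. There \<Omega>
  vanishes and R \<beta> - r is the linear map \<open>L\<close> of \<open>z\<close>, whose kernel is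
  a proper subspace and thus null.\<close>

lemma limit_in_blowup_region:
  fixes X :: "real^'k::{finite,linorder}^'n::{finite,linorder}" and R :: "real^'k::{finite,linorder}^'q"
    and B :: "real^'n::{finite,linorder}^'n::{finite,linorder}"
  assumes rank: "rank X = CARD('k)" and X: "cyclical_design \<omega> X"
    and i: "pos i \<in> {1, 2}" "column i R \<noteq> 0"
    and est: "estimator_conditions X \<beta> \<Omega> {}" and \<mu>: "\<mu>0 \<in> M0 X R r"
    and \<sigma>: "0 < \<sigma>2"
    and B: "\<And>j l. (B ** transpose B) $ j $ l = \<sigma>2 * cos ((real (pos j) - real (pos l)) * \<omega>)"
  shows "AE z in std_gaussian.
    max C 0 * trace (\<Omega> (\<mu>0 + B *v z)) < (norm (R *v \<beta> (\<mu>0 + B *v z) - r))\<^sup>2"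
proof -
  define K :: "real^'k::{finite,linorder}^'n::{finite,linorder}" where "K = (\<chi> j i. if pos i \<in> {1, 2} then X $ j $ i else 0)"
  define D where "D = sqrt \<sigma>2 *\<^sub>R K"
  obtain \<beta>0 where \<beta>0: "\<mu>0 = X *v \<beta>0" "R *v \<beta>0 = r"
    using \<mu> by (auto simp: M0_def)
  obtain P :: "real^'n::{finite,linorder}^'k::{finite,linorder}" where P: "P ** X = mat 1"
    using rank by (auto simp: full_rank_injective matrix_left_invertible_injective[symmetric])
  have PX: "P *v (X *v w) = w" for w
    by (simp add: matrix_vector_mul_assoc P)
  have "(D ** transpose D) $ j $ l = \<sigma>2 * (K ** transpose K) $ j $ l" for j l
  proof -
    have "sqrt \<sigma>2 * a * (sqrt \<sigma>2 * b) = \<sigma>2 * (a * b)" for a b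
      using \<sigma> by (simp add: mult.left_commute[of _ "sqrt \<sigma>2"] mult.assoc[symmetric])
    then show ?thesis
      by (simp only: D_def matrix_matrix_mult_def transpose_def vec_lambda_beta vector_scaleR_component
          real_scaleR_def sum_distrib_left)
  qed
  then have "B ** transpose B = D ** transpose D"
    by (simp add: vec_eq_iff B cyclical_gram[OF X K_def])
  then have range: "range ((*v) B) = range ((*v) D)"
    by (rule range_matrix_eq_if_gram_eq)
  have KX: "K *v w = X *v (\<chi> i. if pos i \<in> {1, 2} then w $ i else 0)" for w
    by (auto simp: K_def vec_eq_iff matrix_vector_mult_def intro!: sum.cong)
  have DX: "D *v w = X *v (sqrt \<sigma>2 *\<^sub>R (\<chi> i. if pos i \<in> {1, 2} then w $ i else 0))" for w
    by (simp add: D_def KX matrix_vector_mult_scaleR scaleR_matrix_vector_assoc[symmetric])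
  \<comment> \<open>The left inverse \<open>P\<close> recovers the regression coefficients of a
    vector in the column space.\<close>
  have BX: "B *v z = X *v (P *v (B *v z))" for z
    using range DX PX by (metis (no_types, lifting) rangeE rangeI)
  define L where "L = R ** (P ** B)"
  have L: "L *v z = R *v (P *v (B *v z))" for z
    by (simp add: L_def matrix_vector_mul_assoc matrix_mul_assoc)
  \<comment> \<open>The witness is sent by \<open>B\<close> to a multiple of the \<open>i\<close>-th
    column of \<open>X\<close>, so \<open>L\<close> maps it to a multiple of the nonzero column
    \<open>i\<close> of \<open>R\<close>.\<close>
  obtain z0 where z0: "B *v z0 = D *v axis i 1"
    using range by (metis (no_types, lifting) rangeE rangeI)
  have "(\<chi> i'. if pos i' \<in> {1, 2} then (axis i (1::real)) $ i' else 0) = axis i 1"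
    using i(1) by (auto simp: vec_eq_iff axis_def)
  then have "L *v z0 = sqrt \<sigma>2 *\<^sub>R column i R"
    unfolding L z0 DX PX by (simp add: matrix_vector_mult_scaleR matrix_vector_mul_component matrix_vector_mult_basis)
  then have "L *v z0 \<noteq> 0" using i(2) \<sigma> by simp
  then have "AE z in std_gaussian. L *v z \<noteq> 0"
    by (intro AE_std_gaussian_if_negligible) (simp add: negligible_kernel)
  then show ?thesis
  proof eventually_elim
    case (elim z)
    have y: "\<mu>0 + B *v z = X *v (\<beta>0 + P *v (B *v z))"
      using BX[of z] by (simp add: \<beta>0(1) matrix_vector_right_distrib)
    have "R *v \<beta> (\<mu>0 + B *v z) - r = L *v z" "\<Omega> (\<mu>0 + B *v z) = 0"
      unfolding y estimators_on_span[OF est] by (simp_all add: matrix_vector_right_distrib \<beta>0(2) L)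
    then show ?case using elim by (simp add: trace_def)
  qed
qed

text \<open>The inclusion of the two events holds only where \<Omega> is nonsingular, because the
  statistic is 0 elsewhere. Nonsingularity of \<open>B\<close> makes the exceptional set
  null.\<close>

lemma gaussian_measure_F_type_statistic_ge:
  fixes R :: "real^'k^'q" and B :: "real^'n^'n"
  assumes est: "estimator_conditions X \<beta> \<Omega> {}"
    and psd: "\<And>y. nonneg_definite (\<Omega> y)" and B: "det B \<noteq> 0"
  shows "measure (distr std_gaussian borel (\<lambda>z. \<mu> + B *v z))
      {y. max C 0 * trace (\<Omega> y) < (norm (R *v \<beta> y - r))\<^sup>2}
    \<le> measure (distr std_gaussian borel (\<lambda>z. \<mu> + B *v z)) {y. F_type_statistic R r \<beta> \<Omega> {} y \<ge> C}"
    (is "measure ?M ?U \<le> measure ?M ?T")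
proof -
  have meas: "(\<lambda>z. \<mu> + B *v z) \<in> std_gaussian \<rightarrow>\<^sub>M borel"
    by (rule affine_borel_measurable)
  interpret prob_space ?M
    by (intro prob_space.prob_space_distr prob_space_std_gaussian meas)
  have c\<beta>: "continuous_on UNIV \<beta>" and c\<Omega>: "continuous_on UNIV \<Omega>"
    and ae: "AE y in lebesgue. det (\<Omega> y) \<noteq> 0"
    using est by (simp_all add: estimator_conditions_def)
  have [measurable]: "F_type_statistic R r \<beta> \<Omega> {} \<in> borel_measurable borel"
    by (rule F_type_statistic_measurable[OF c\<beta> c\<Omega>])
  have T [measurable]: "?T \<in> sets borel" by measurable
  have neg: "negligible {y. \<not> det (\<Omega> y) \<noteq> 0}"
  proof -
    obtain N where "{y \<in> space lebesgue. \<not> det (\<Omega> y) \<noteq> 0} \<subseteq> N" "N \<in> null_sets lebesgue"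
      using ae unfolding eventually_ae_filter by blast
    then have "negligible N" "{y. \<not> det (\<Omega> y) \<noteq> 0} \<subseteq> N"
      by (simp_all add: negligible_iff_null_sets)
    then show ?thesis by (rule negligible_subset)
  qed
  have "AE z in std_gaussian. det (\<Omega> (\<mu> + B *v z)) \<noteq> 0"
    by (rule AE_std_gaussian_affine[OF B neg])
  then have "AE z in std_gaussian. \<mu> + B *v z \<in> ?U \<longrightarrow> \<mu> + B *v z \<in> ?T"
    by eventually_elim (simp only: mem_Collect_eq, intro impI F_type_statistic_ge[OF psd])
  moreover have "{y \<in> space borel. y \<in> ?U \<longrightarrow> y \<in> ?T} \<in> sets borel"
  proof -
    have "?U \<in> sets borel"
      by (rule borel_open[OF open_blowup_region[OF c\<beta> c\<Omega>]])
    then have "- ?U \<union> ?T \<in> sets borel"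
      using T by (intro sets.Un borel_comp)
    moreover have "{y \<in> space borel. y \<in> ?U \<longrightarrow> y \<in> ?T} = - ?U \<union> ?T" by auto
    ultimately show ?thesis by (simp only:)
  qed
  ultimately have "AE y in ?M. y \<in> ?U \<longrightarrow> y \<in> ?T"
    by (rule AE_distr_iff[OF meas, THEN iffD2, rotated])
  then show ?thesis
    by (rule finite_measure_mono_AE) simp
qed

theorem theorem5p12:
  fixes X :: "real^'k::{finite,linorder}^'n::{finite,linorder}"
    and R :: "real^'k::{finite,linorder}^'q::finite"
    and r :: "real^'q"
    and \<omega> :: real
    and \<FF> :: "(real \<Rightarrow> real) set"
    and \<beta> :: "real^'n::{finite,linorder} \<Rightarrow> real^'k::{finite,linorder}"
    and \<Omega> :: "real^'n::{finite,linorder} \<Rightarrow> real^'q^'q"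
    and C \<sigma>2 :: real
    and \<mu>0 :: "real^'n::{finite,linorder}"
  assumes "CARD('k) < CARD('n)"
    and "rank X = CARD('k)"
    and "rank R = CARD('q)"
    and "\<FF> \<subseteq> F_all"
    and "F_AR2 \<subseteq> \<FF>"
    and "0 < \<omega>" and "\<omega> < pi"
    and "cyclical_design \<omega> X"
    and "\<exists>i. pos i \<in> {1, 2} \<and> column i R \<noteq> 0"
    and "estimator_conditions X \<beta> \<Omega> {}"
    and "\<And>y. nonneg_definite (\<Omega> y)"
    and "\<mu>0 \<in> M0 X R r"
    and "0 < \<sigma>2"
  shows "(SUP f\<in>\<FF>. measure (gaussian \<mu>0 (\<sigma>2 *\<^sub>R Sigma_mat f))
            {y. F_type_statistic R r \<beta> \<Omega> {} y \<ge> C}) = 1"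
proof -
  let ?T = "{y. F_type_statistic R r \<beta> \<Omega> {} y \<ge> C}"
  \<comment> \<open>In the limit \<Omega> vanishes almost surely and the statistic takes its default
    value 0, so the event \<open>?T\<close> itself cannot be passed to the limit; the open set
    \<open>U\<close> can.\<close>
  define U where "U = {y. max C 0 * trace (\<Omega> y) < (norm (R *v \<beta> y - r))\<^sup>2}"
  have c\<beta>: "continuous_on UNIV \<beta>" and c\<Omega>: "continuous_on UNIV \<Omega>"
    using assms(10) by (simp_all add: estimator_conditions_def)
  have "open U"
    unfolding U_def by (rule open_blowup_region[OF c\<beta> c\<Omega>])
  obtain i where i: "pos i \<in> {1, 2}" "column i R \<noteq> 0"
    using assms(9) by blast
  obtain f :: "nat \<Rightarrow> real \<Rightarrow> real" where f: "\<And>m. f m \<in> F_AR2"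
    and sym: "\<And>m. transpose (Sigma_mat (f m)) = (Sigma_mat (f m) :: real^'n::{finite,linorder}^'n::{finite,linorder})"
    and pd: "\<And>m (v :: real^'n::{finite,linorder}). v \<noteq> 0 \<Longrightarrow> 0 < v \<bullet> (Sigma_mat (f m) *v v)"
    and tr: "\<And>m. trace (Sigma_mat (f m) :: real^'n::{finite,linorder}^'n::{finite,linorder}) = CARD('n)"
    and lim: "\<And>j l :: 'n::{finite,linorder}. (\<lambda>m. Sigma_mat (f m) $ j $ l) \<longlonglongrightarrow> cos ((real (pos j) - real (pos l)) * \<omega>)"
    by (rule resonant_covariances[OF assms(6,7)]) blast
  define A :: "nat \<Rightarrow> real^'n::{finite,linorder}^'n::{finite,linorder}" where "A m = \<sigma>2 *\<^sub>R Sigma_mat (f m)" for m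
  have A: "v \<noteq> 0 \<Longrightarrow> 0 < v \<bullet> (A m *v v)" "transpose (A m) = A m" for m v
    using assms(13) pd[of v m] sym[of m]
    by (simp_all add: A_def scaleR_matrix_vector_assoc[symmetric] transpose_scalar)
  have "\<exists>B. B ** transpose B = A m \<and> det B \<noteq> 0 \<and>
      gaussian \<mu>0 (A m) = distr std_gaussian borel (\<lambda>z. \<mu>0 + B *v z)" for m
    by (rule gaussian_square_root[OF A]) blast+
  then obtain B where "\<forall>m. B m ** transpose (B m) = A m \<and> det (B m) \<noteq> 0 \<and>
      gaussian \<mu>0 (A m) = distr std_gaussian borel (\<lambda>z. \<mu>0 + B m *v z)"
    by (rule choice[OF allI, THEN exE])
  then have B: "\<And>m. B m ** transpose (B m) = A m" "\<And>m. det (B m) \<noteq> 0"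
    "\<And>m. gaussian \<mu>0 (A m) = distr std_gaussian borel (\<lambda>z. \<mu>0 + B m *v z)"
    by blast+
  have "trace (B m ** transpose (B m)) = \<sigma>2 * CARD('n)" for m
    using tr[of m] by (simp add: B A_def trace_def sum_distrib_left[symmetric])
  \<comment> \<open>The square roots chosen by \<open>SOME\<close> need not converge, but they are bounded.\<close>
  then obtain B0 \<phi> where \<phi>: "strict_mono \<phi>" "(B \<circ> \<phi>) \<longlonglongrightarrow> B0"
    by (rule matrix_sequence_convergent_subsequence)
  have "B0 ** transpose B0 = (\<chi> j l. \<sigma>2 * cos ((real (pos j) - real (pos l)) * \<omega>))"
  proof (rule gram_limit[OF \<phi>(2)])
    fix j l :: "'n::{finite,linorder}"
    have "(\<lambda>m. \<sigma>2 * Sigma_mat (f (\<phi> m)) $ j $ l) \<longlonglongrightarrow> \<sigma>2 * cos ((real (pos j) - real (pos l)) * \<omega>)"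
      using LIMSEQ_subseq_LIMSEQ[OF lim \<phi>(1)] by (intro tendsto_mult tendsto_const) (simp add: o_def)
    then show "(\<lambda>m. ((B \<circ> \<phi>) m ** transpose ((B \<circ> \<phi>) m)) $ j $ l)
        \<longlonglongrightarrow> (\<chi> j l. \<sigma>2 * cos ((real (pos j) - real (pos l)) * \<omega>)) $ j $ l"
      by (simp add: B(1) A_def)
  qed
  then have "AE z in std_gaussian. \<mu>0 + B0 *v z \<in> U"
    unfolding U_def mem_Collect_eq
    by (intro limit_in_blowup_region[OF assms(2,8) i assms(10,12,13)]) simp
  then have "(\<lambda>m. measure (distr std_gaussian borel (\<lambda>z. \<mu>0 + (B \<circ> \<phi>) m *v z)) U) \<longlonglongrightarrow> 1"
    by (rule measure_std_gaussian_affine_tendsto[OF \<open>open U\<close> \<phi>(2)])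
  \<comment> \<open>Before the limit the covariances are nonsingular, so \<open>U\<close> is almost
    surely contained in \<open>?T\<close>, and each density used belongs to
    \<open>\<FF>\<close>.\<close>
  moreover have "measure (distr std_gaussian borel (\<lambda>z. \<mu>0 + (B \<circ> \<phi>) m *v z)) U
      \<le> (SUP f\<in>\<FF>. measure (gaussian \<mu>0 (\<sigma>2 *\<^sub>R Sigma_mat f)) ?T)" for m
  proof -
    have "measure (distr std_gaussian borel (\<lambda>z. \<mu>0 + B (\<phi> m) *v z)) U
        \<le> measure (gaussian \<mu>0 (\<sigma>2 *\<^sub>R Sigma_mat (f (\<phi> m)))) ?T"
      unfolding U_def A_def[symmetric] B(3)
      by (rule gaussian_measure_F_type_statistic_ge[OF assms(10,11) B(2)])
    also have "\<dots> \<le> (SUP f\<in>\<FF>. measure (gaussian \<mu>0 (\<sigma>2 *\<^sub>R Sigma_mat f)) ?T)"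
    proof (rule cSUP_upper)
      show "f (\<phi> m) \<in> \<FF>" using f assms(5) by blast
      show "bdd_above ((\<lambda>f. measure (gaussian \<mu>0 (\<sigma>2 *\<^sub>R Sigma_mat f)) ?T) ` \<FF>)"
        using prob_space.prob_le_1[OF prob_space_gaussian] by (intro bdd_aboveI[of _ 1]) blast
    qed
    finally show ?thesis by simp
  qed
  ultimately have "1 \<le> (SUP f\<in>\<FF>. measure (gaussian \<mu>0 (\<sigma>2 *\<^sub>R Sigma_mat f)) ?T)"
    by (intro LIMSEQ_le_const2) blast+
  \<comment> \<open>The real supremum requires a nonempty index set, for which \<open>f 0\<close> is
    the witness.\<close>
  moreover have "(SUP f\<in>\<FF>. measure (gaussian \<mu>0 (\<sigma>2 *\<^sub>R Sigma_mat f)) ?T) \<le> 1"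
    using f[of 0] assms(5) by (intro cSUP_least prob_space.prob_le_1[OF prob_space_gaussian]) blast
  ultimately show ?thesis by simp
qed

end
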